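(* Let $G=(V,E,w)$ be a connected graph and let $\mu,\nu\in\mathscr{P}(V)$. Let $\mathcal{R}(\mu,\nu):=(\mu-\nu)^\top L_w^\dagger(\mu-\nu)$. Then the following hold. 1. (Beckmann formula) Let $E'$ be an orientation of $E$ and let $B\in\mathbb{R}^{V\times E'}$ be the corresponding oriented incidence matrix. Then $$\mathcal{R}(\mu,\nu)=\inf\left\{\sum_{e\in E'}\frac{|J(e)|^2}{w_e}\;:\;J\in\mathbb{R}^{E'},\ BJ=\mu-\nu\right\}.$$ 2. (Benamou--Brenier formula) Let $E'$ be an orientation of $E$ with oriented incidence matrix $B$. Then $$\mathcal{R}(\mu,\nu)=\inf\left\{\int_0^1\sum_{e\in E'}\frac{|J_t(e)|^2}{w_e}\,dt\;:\;\frac{d}{dt}\rho_t+BJ_t=0,\ \rho_0=\mu,\ \rho_1=\nu\right\},$$ where the infimum is over all $\rho\in\mathcal{C}^1([0,1];\mathbb{R}^V)$ and all Borel measurable $J:[0,1]\to\mathbb{R}^{E'}$ satisfying the listed constraints (the differential equation holding for all $t\in[0,1]$). 3. (Negative homogeneous Sobolev distance) $\mathcal{R}(\mu,\nu)=\|\mu-\nu\|_{\dot H^{-1}(V,w)}^2$, where $\|\cdot\|_{\dot H^{-1}(V,w)}$ is the norm on $\mathbb{R}^V_0$ dual to $\|f\|_{\dot H^1(V,w)}^2:=\sum_{\{x,y\}\in E}w_{xy}|f(x)-f(y)|^2$, $f\in\mathbb{R}^V_0$; that is, $$\|g\|_{\dot H^{-1}(V,w)}^2=\sup_{f\in\mathbb{R}^V_0\setminus\{0\}}\frac{\langle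 f,g\rangle^2}{\|f\|_{\dot H^1(V,w)}^2},\quad \langle f,g\rangle=\sum_{x\in V}f(x)g(x).$$ 4. (Spanning $2$-forest formula) $$\mathcal{R}(\mu,\nu)=\frac{1}{\mathcal{T}(G)}\sum_{\substack{F\in\mathcal{F}(G) \\ F=T_1\cup T_2}}w_F\,(\mu(T_1)-\nu(T_1))^2,$$ where $\mathcal{T}(G)$ is the sum of the weights $w_T$ over all spanning trees $T$ of $G$, and the sum on the right runs over the set $\mathcal{F}(G)$ of all spanning $2$-forests $F$ of $G$, with components $T_1$ and $T_2$. 5. (Hitting time formula) For $x,y\in V$ let $\mathrm{H}(x,y)$ be the expected number of steps for the simple random walk on $V$ to reach $y$ having started at $x$. Then $$\mathcal{R}(\mu,\nu)=-\frac{1}{\mathrm{Vol}_w(G)}\sum_{x,y\in V}(\mu(x)-\nu(x))(\mu(y)-\nu(y))\,\mathrm{H}(x,y).$$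
   Context: A graph $G=(V,E,w)$ consists of a finite vertex set $V$, a set $E$ of $m\ge 1$ undirected edges (unordered pairs of distinct vertices), and positive edge weights $w=(w_{xy})_{\{x,y\}\in E}$ (with $w_{xy}=w_{yx}$). Write $y\sim x$ if $\{x,y\}\in E$. The degree of $x$ is $\mathrm{d}_x=\sum_{y\sim x}w_{xy}$; $D_w$ is the diagonal degree matrix, $A_w$ the weighted adjacency matrix, $L_w=D_w-A_w$ the Laplacian matrix, and $\mathrm{Vol}_w(G)=\sum_{x\in V}\mathrm{d}_x$. $X^\dagger$ denotes the Moore--Penrose inverse. $\mathscr{P}(V)$ is the simplex of probability densities on $V$ (nonnegative vectors in $\mathbb{R}^V$ with entries summing to $1$), and $\mathbb{R}^V_0=\{f\in\mathbb{R}^V:\sum_xf(x)=0\}$. An orientation $E'$ of $E$ is a choice, for each edge $\{x,y\}\in E$, of exactly one of the ordered pairs $(x,y)$, $(y,x)$; for $e=(x,y)\in E'$, $w_e=w_{xy}$. The oriented incidence matrix $B\in\mathbb{R}^{V\times E'}$ has entries $B_{x,(u,v)}=1$ if $x=u$, $-1$ if $x=v$, and $0$ otherwise. For $F\subseteq E$, $w_F=\prod_{e\in F}w_e$ (empty product $=1$). A spanning $2$-forest of $G$ is a set $F\subseteq E$ of edges such that $(V,F)$ is acyclic with exactly two connected components $T_1,T_2$ (a component may be a single isolated vertex); $\mu(T_i)=\sum_{x}\mu(x)$ over the vertices $x$ of $T_i$. (The summand does not depend on which component is labelled $T_1$.) The simple random walk is the Markov chain $(X_t)_{t\ge0}$ on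 $V$ with transition matrix $P=D_w^{-1}A_w$; $\mathrm{H}(x,y)=\mathbb{E}(T_y\mid X_0=x)$ with $T_y=\inf\{t\ge0:X_t=y\}$. *)

theory Defs
  imports "HOL-Probability.Probability"
begin

section \<open>Weighted graphs\<close>

text \<open>
  The finite vertex set is the universe of a type of class \<^class>\<open>finite\<close>. Edges are
  two-element sets of vertices, and the weight \<open>w\<^sub>x\<^sub>y\<close> is the value of \<open>w\<close> at the edge \<open>{x, y}\<close>;
  values of \<open>w\<close> outside the edge set are irrelevant.
\<close>

definition weighted_graph :: "'v::finite set set \<Rightarrow> ('v set \<Rightarrow> real) \<Rightarrow> bool" where
  "weighted_graph E w \<longleftrightarrow>
     E \<noteq> {} \<and> (\<forall>e\<in>E. \<exists>x y. x \<noteq> y \<and> e = {x, y}) \<and> (\<forall>e\<in>E. 0 < w e)"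

definition adj_rel :: "'v set set \<Rightarrow> ('v \<times> 'v) set" where
  "adj_rel F = {(x, y). {x, y} \<in> F}"

definition edges_connected :: "'v set set \<Rightarrow> bool" where
  "edges_connected F \<longleftrightarrow> (\<forall>x y. (x, y) \<in> (adj_rel F)\<^sup>*)"

text \<open>Vertex sets of the connected components of \<open>(V, F)\<close>, isolated vertices included.\<close>

definition edge_components :: "'v set set \<Rightarrow> 'v set set" where
  "edge_components F = UNIV // (adj_rel F)\<^sup>*"

text \<open>A cycle is given by the list of its pairwise distinct vertices, at least three of them.\<close>

definition is_cycle :: "'v set set \<Rightarrow> 'v list \<Rightarrow> bool" where
  "is_cycle F xs \<longleftrightarrow> 3 \<le> length xs \<and> distinct xs \<and>
     (\<forall>i<length xs. {xs ! i, xs ! (Suc i mod length xs)} \<in> F)"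

definition edges_acyclic :: "'v set set \<Rightarrow> bool" where
  "edges_acyclic F \<longleftrightarrow> (\<nexists>xs. is_cycle F xs)"

definition spanning_trees :: "'v set set \<Rightarrow> 'v set set set" where
  "spanning_trees E = {F. F \<subseteq> E \<and> edges_acyclic F \<and> edges_connected F}"

definition spanning_2_forests :: "'v set set \<Rightarrow> 'v set set set" where
  "spanning_2_forests E = {F. F \<subseteq> E \<and> edges_acyclic F \<and> card (edge_components F) = 2}"

definition weight_prod :: "('v set \<Rightarrow> real) \<Rightarrow> 'v set set \<Rightarrow> real" where
  "weight_prod w F = (\<Prod>e\<in>F. w e)"

definition tree_weight_sum :: "'v::finite set set \<Rightarrow> ('v set \<Rightarrow> real) \<Rightarrow> real" where
  "tree_weight_sum E w = (\<Sum>F\<in>spanning_trees E. weight_prod w F)"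


section \<open>Matrices of a weighted graph\<close>

definition deg :: "'v::finite set set \<Rightarrow> ('v set \<Rightarrow> real) \<Rightarrow> 'v \<Rightarrow> real" where
  "deg E w x = (\<Sum>y | {x, y} \<in> E. w {x, y})"

definition vol :: "'v::finite set set \<Rightarrow> ('v set \<Rightarrow> real) \<Rightarrow> real" where
  "vol E w = (\<Sum>x\<in>UNIV. deg E w x)"

definition degree_matrix :: "'v::finite set set \<Rightarrow> ('v set \<Rightarrow> real) \<Rightarrow> real^'v^'v" where
  "degree_matrix E w = (\<chi> x y. if x = y then deg E w x else 0)"

definition adjacency_matrix :: "'v::finite set set \<Rightarrow> ('v set \<Rightarrow> real) \<Rightarrow> real^'v^'v" where
  "adjacency_matrix E w = (\<chi> x y. if {x, y} \<in> E then w {x, y} else 0)"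

definition laplacian :: "'v::finite set set \<Rightarrow> ('v set \<Rightarrow> real) \<Rightarrow> real^'v^'v" where
  "laplacian E w = degree_matrix E w - adjacency_matrix E w"

text \<open>The Moore--Penrose inverse is the unique solution of the four Penrose equations.\<close>

definition is_pseudoinverse :: "real^'n^'m \<Rightarrow> real^'m^'n \<Rightarrow> bool" where
  "is_pseudoinverse A X \<longleftrightarrow>
     A ** X ** A = A \<and> X ** A ** X = X \<and>
     transpose (A ** X) = A ** X \<and> transpose (X ** A) = X ** A"

definition pseudoinverse :: "real^'n^'m \<Rightarrow> real^'m^'n" where
  "pseudoinverse A = (THE X. is_pseudoinverse A X)"

lemma is_pseudoinverse_unique:
  fixes A :: "real^'n^'m"
  assumes X: "is_pseudoinverse A X" and Y: "is_pseudoinverse A Y"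
  shows "X = Y"
proof -
  have AXY: "A ** X = A ** Y"
  proof -
    have "A ** X = transpose (A ** Y ** A ** X)"
      using X Y by (simp add: is_pseudoinverse_def)
    also have "\<dots> = transpose (A ** X) ** transpose (A ** Y)"
      by (simp add: matrix_transpose_mul[symmetric] matrix_mul_assoc)
    also have "\<dots> = A ** X ** A ** Y"
      using X Y by (simp add: is_pseudoinverse_def matrix_mul_assoc)
    also have "\<dots> = A ** Y"
      using X by (simp add: is_pseudoinverse_def)
    finally show ?thesis .
  qed
  have XYA: "X ** A = Y ** A"
  proof -
    have "X ** A = transpose (X ** (A ** Y ** A))"
      using X Y by (simp add: is_pseudoinverse_def)
    also have "\<dots> = transpose (Y ** A) ** transpose (X ** A)"
      by (simp add: matrix_transpose_mul[symmetric] matrix_mul_assoc)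
    also have "\<dots> = (Y ** A) ** (X ** A)"
      using X Y by (simp add: is_pseudoinverse_def)
    also have "\<dots> = Y ** (A ** X ** A)"
      by (simp only: matrix_mul_assoc)
    also have "\<dots> = Y ** A"
      using X unfolding is_pseudoinverse_def by presburger
    finally show ?thesis .
  qed
  have "X = X ** A ** X" using X by (simp add: is_pseudoinverse_def)
  also have "\<dots> = Y ** (A ** X)" by (simp add: XYA matrix_mul_assoc)
  also have "\<dots> = Y ** A ** Y" by (simp add: AXY matrix_mul_assoc)
  also have "\<dots> = Y" using Y by (simp add: is_pseudoinverse_def)
  finally show ?thesis .
qed

definition prob_density :: "real^'v::finite \<Rightarrow> bool" where
  "prob_density \<mu> \<longleftrightarrow> (\<forall>x. 0 \<le> \<mu> $ x) \<and> (\<Sum>x\<in>UNIV. \<mu> $ x) = 1"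

definition mass :: "real^'v::finite \<Rightarrow> 'v set \<Rightarrow> real" where
  "mass \<mu> T = (\<Sum>x\<in>T. \<mu> $ x)"

definition resistance ::
  "'v::finite set set \<Rightarrow> ('v set \<Rightarrow> real) \<Rightarrow> real^'v \<Rightarrow> real^'v \<Rightarrow> real" where
  "resistance E w \<mu> \<nu> = (\<mu> - \<nu>) \<bullet> (pseudoinverse (laplacian E w) *v (\<mu> - \<nu>))"


section \<open>Orientations and flows\<close>

definition orientation :: "'v set set \<Rightarrow> ('v \<times> 'v) set \<Rightarrow> bool" where
  "orientation E E' \<longleftrightarrow>
     (\<forall>(x, y)\<in>E'. {x, y} \<in> E) \<and>
     (\<forall>x y. {x, y} \<in> E \<longrightarrow> ((x, y) \<in> E') \<noteq> ((y, x) \<in> E'))"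

definition oriented_weight :: "('v set \<Rightarrow> real) \<Rightarrow> 'v \<times> 'v \<Rightarrow> real" where
  "oriented_weight w e = w {fst e, snd e}"

definition incidence :: "'v \<Rightarrow> 'v \<times> 'v \<Rightarrow> real" where
  "incidence x e = (if x = fst e then 1 else if x = snd e then -1 else 0)"

text \<open>
  The edge set \<open>E'\<close> is not a type, so \<open>\<real>\<^bsup>E'\<^esup>\<close> is rendered as the set \<open>E' \<rightarrow>\<^sub>E UNIV\<close> of functions
  determined by their values on \<open>E'\<close>; its Borel algebra is that of the product measure
  space below.
\<close>

definition incidence_mult :: "('v::finite \<times> 'v) set \<Rightarrow> ('v \<times> 'v \<Rightarrow> real) \<Rightarrow> real^'v" where
  "incidence_mult E' J = (\<chi> x. \<Sum>e\<in>E'. incidence x e * J e)"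

definition flow_energy ::
  "('v set \<Rightarrow> real) \<Rightarrow> ('v \<times> 'v) set \<Rightarrow> ('v \<times> 'v \<Rightarrow> real) \<Rightarrow> real" where
  "flow_energy w E' J = (\<Sum>e\<in>E'. \<bar>J e\<bar>\<^sup>2 / oriented_weight w e)"

text \<open>Derivatives at the end points of \<open>[0, 1]\<close> are one-sided.\<close>

definition C1_unit_interval :: "(real \<Rightarrow> 'a::real_normed_vector) \<Rightarrow> bool" where
  "C1_unit_interval \<rho> \<longleftrightarrow>
     (\<forall>t\<in>{0..1}. \<rho> differentiable (at t within {0..1})) \<and>
     continuous_on {0..1} (\<lambda>t. vector_derivative \<rho> (at t within {0..1}))"

definition admissible_path ::
  "('v::finite \<times> 'v) set \<Rightarrow> real^'v \<Rightarrow> real^'v \<Rightarrow>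
    (real \<Rightarrow> real^'v) \<Rightarrow> (real \<Rightarrow> 'v \<times> 'v \<Rightarrow> real) \<Rightarrow> bool" where
  "admissible_path E' \<mu> \<nu> \<rho> J \<longleftrightarrow>
     C1_unit_interval \<rho> \<and>
     J \<in> restrict_space borel {0..1} \<rightarrow>\<^sub>M (\<Pi>\<^sub>M e\<in>E'. borel) \<and>
     (\<forall>t\<in>{0..1}. vector_derivative \<rho> (at t within {0..1}) + incidence_mult E' (J t) = 0) \<and>
     \<rho> 0 = \<mu> \<and> \<rho> 1 = \<nu>"

text \<open>The action of a Borel flow may be infinite.\<close>

definition path_action ::
  "('v set \<Rightarrow> real) \<Rightarrow> ('v \<times> 'v) set \<Rightarrow> (real \<Rightarrow> 'v \<times> 'v \<Rightarrow> real) \<Rightarrow> ereal" where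
  "path_action w E' J = enn2ereal (\<integral>\<^sup>+t\<in>{0..1}. ennreal (flow_energy w E' (J t)) \<partial>lborel)"


section \<open>Homogeneous Sobolev norms\<close>

definition mean_zero :: "(real^'v::finite) set" where
  "mean_zero = {f. (\<Sum>x\<in>UNIV. f $ x) = 0}"

definition edge_diff :: "real^'v::finite \<Rightarrow> 'v set \<Rightarrow> real" where
  "edge_diff f e = (THE d. \<exists>x y. e = {x, y} \<and> d = \<bar>f $ x - f $ y\<bar>)"

lemma edge_diff_pair: "edge_diff f {x, y} = \<bar>f $ x - f $ y\<bar>"
  unfolding edge_diff_def by (rule the_equality) (auto simp: doubleton_eq_iff abs_minus_commute)

definition H1_norm_sq :: "'v::finite set set \<Rightarrow> ('v set \<Rightarrow> real) \<Rightarrow> real^'v \<Rightarrow> real" where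
  "H1_norm_sq E w f = (\<Sum>e\<in>E. w e * (edge_diff f e)\<^sup>2)"

definition Hneg1_norm_sq :: "'v::finite set set \<Rightarrow> ('v set \<Rightarrow> real) \<Rightarrow> real^'v \<Rightarrow> ereal" where
  "Hneg1_norm_sq E w g = (SUP f\<in>mean_zero - {0}. ereal ((f \<bullet> g)\<^sup>2 / H1_norm_sq E w f))"


section \<open>Simple random walk\<close>

definition transition_matrix :: "'v::finite set set \<Rightarrow> ('v set \<Rightarrow> real) \<Rightarrow> real^'v^'v" where
  "transition_matrix E w = matrix_inv (degree_matrix E w) ** adjacency_matrix E w"

definition step_pmf :: "'v::finite set set \<Rightarrow> ('v set \<Rightarrow> real) \<Rightarrow> 'v \<Rightarrow> 'v pmf" where
  "step_pmf E w x = embed_pmf (\<lambda>y. transition_matrix E w $ x $ y)"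

text \<open>
  The law on trajectories \<open>nat \<Rightarrow> 'v\<close> of the walk started at \<open>x\<close>, as an Ionescu-Tulcea limit.
  The theorem \<open>emeasure_walk_law_cylinder\<close> below identifies it as the law of the Markov chain with
  matrix \<^const>\<open>transition_matrix\<close> and initial state \<open>x\<close>.
\<close>

definition walk_kernel ::
  "'v::finite set set \<Rightarrow> ('v set \<Rightarrow> real) \<Rightarrow> 'v \<Rightarrow> nat \<Rightarrow> (nat \<Rightarrow> 'v) \<Rightarrow> 'v measure" where
  "walk_kernel E w x t \<omega> =
     (case t of 0 \<Rightarrow> return (count_space UNIV) x | Suc s \<Rightarrow> measure_pmf (step_pmf E w (\<omega> s)))"

definition walk_law ::
  "'v::finite set set \<Rightarrow> ('v set \<Rightarrow> real) \<Rightarrow> 'v \<Rightarrow> (nat \<Rightarrow> 'v) measure" where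
  "walk_law E w x =
     projective_family.lim UNIV
       (Ionescu_Tulcea.CI (walk_kernel E w x) (\<lambda>_. count_space UNIV)) (\<lambda>_. count_space UNIV)"

text \<open>The infimum of the empty set is \<open>\<infinity>\<close>.\<close>

definition hitting_time :: "'v \<Rightarrow> (nat \<Rightarrow> 'v) \<Rightarrow> ennreal" where
  "hitting_time y \<omega> = (INF t\<in>{t. \<omega> t = y}. of_nat t)"

definition expected_hitting_time ::
  "'v::finite set set \<Rightarrow> ('v set \<Rightarrow> real) \<Rightarrow> 'v \<Rightarrow> 'v \<Rightarrow> ennreal" where
  "expected_hitting_time E w x y = (\<integral>\<^sup>+\<omega>. hitting_time y \<omega> \<partial>walk_law E w x)"


subsection \<open>The law of the walk is the law of the Markov chain\<close>

lemma weight_pos: "weighted_graph E w \<Longrightarrow> e \<in> E \<Longrightarrow> 0 < w e"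
  unfolding weighted_graph_def by blast

lemma deg_pos:
  assumes G: "weighted_graph E w" and con: "edges_connected E"
  shows "0 < deg E w x"
proof -
  obtain e where e: "e \<in> E"
    using G by (auto simp: weighted_graph_def)
  then have "\<exists>a b. a \<noteq> b \<and> e = {a, b}"
    using G by (simp add: weighted_graph_def)
  then obtain a b :: 'a where ab: "a \<noteq> b" by blast
  then obtain z where z: "z \<noteq> x" by metis
  have "(x, z) \<in> (adj_rel E)\<^sup>*" using con by (simp add: edges_connected_def)
  then obtain y where "(x, y) \<in> adj_rel E"
    using z by (cases rule: converse_rtranclE) auto
  then have y: "{x, y} \<in> E" by (simp add: adj_rel_def)
  have "0 < w {x, y}" using weight_pos[OF G y] .
  also have "\<dots> \<le> deg E w x"
    unfolding deg_def
  proof (rule member_le_sum)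
    show "y \<in> {y. {x, y} \<in> E}" using y by simp
    show "0 \<le> w {x, v}" if "v \<in> {y. {x, y} \<in> E} - {y}" for v
      using that weight_pos[OF G] by (simp add: less_imp_le)
  qed simp
  finally show ?thesis .
qed

lemma diagonal_matrix_mult:
  fixes A :: "real^'n::finite^'n"
  shows "((\<chi> x y. if x = y then c x else 0) ** A) $ x $ y = c x * A $ x $ y"
proof -
  have "(\<Sum>k\<in>UNIV. (if x = k then c x else 0) * A $ k $ y)
      = (\<Sum>k\<in>UNIV. if x = k then c x * A $ k $ y else 0)"
    by (rule sum.cong) auto
  then show ?thesis by (simp add: matrix_matrix_mult_def)
qed

lemma transition_matrix_entry:
  assumes G: "weighted_graph E w" and con: "edges_connected E"
  shows "transition_matrix E w $ x $ y = adjacency_matrix E w $ x $ y / deg E w x"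
proof -
  let ?D = "degree_matrix E w"
  let ?I = "(\<chi> x y. if x = y then 1 / deg E w x else 0) :: real^'a^'a"
  have nz: "deg E w x \<noteq> 0" for x using deg_pos[OF G con, of x] by simp
  have D: "?D ** ?I = mat 1"
    unfolding vec_eq_iff degree_matrix_def diagonal_matrix_mult by (simp add: mat_def nz)
  have I: "?I ** ?D = mat 1"
    unfolding vec_eq_iff diagonal_matrix_mult by (simp add: degree_matrix_def mat_def nz)
  have inv: "?D ** matrix_inv ?D = mat 1 \<and> matrix_inv ?D ** ?D = mat 1"
    unfolding matrix_inv_def by (rule someI[of _ ?I]) (use D I in blast)
  have "matrix_inv ?D = matrix_inv ?D ** (?D ** ?I)"
    unfolding D by (rule matrix_mul_rid[symmetric])
  also have "\<dots> = ?I"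
    using inv by (simp add: matrix_mul_assoc)
  finally show ?thesis
    unfolding transition_matrix_def by (simp add: diagonal_matrix_mult)
qed

lemma pmf_step_pmf:
  assumes G: "weighted_graph E w" and con: "edges_connected E"
  shows "pmf (step_pmf E w x) y = transition_matrix E w $ x $ y"
proof -
  have d: "0 < deg E w x" by (rule deg_pos[OF G con])
  have nn: "0 \<le> transition_matrix E w $ x $ y" for y
    using d weight_pos[OF G] by (simp add: transition_matrix_entry[OF G con]
        adjacency_matrix_def less_imp_le)
  have "(\<Sum>y\<in>UNIV. transition_matrix E w $ x $ y) = 1"
    using d by (simp add: transition_matrix_entry[OF G con] adjacency_matrix_def deg_def
        sum_divide_distrib[symmetric] sum.If_cases)
  then have "(\<integral>\<^sup>+y. ennreal (transition_matrix E w $ x $ y) \<partial>count_space UNIV) = 1"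
    using nn by (simp add: nn_integral_count_space_finite sum_ennreal)
  with nn show ?thesis
    unfolding step_pmf_def by (intro pmf_embed_pmf) auto
qed

lemma walk_Ionescu_Tulcea: "Ionescu_Tulcea (walk_kernel E w x) (\<lambda>_. count_space UNIV)"
proof (rule Ionescu_Tulcea.intro)
  fix i
  show "walk_kernel E w x i \<in> Pi\<^sub>M {0..<i} (\<lambda>_. count_space UNIV) \<rightarrow>\<^sub>M subprob_algebra (count_space UNIV)"
  proof (cases i)
    case 0
    then show ?thesis
      by (simp add: walk_kernel_def[abs_def] prob_space_return prob_space_imp_subprob_space
          space_subprob_algebra)
  next
    case (Suc s)
    have "(\<lambda>y. measure_pmf (step_pmf E w y)) \<in> count_space UNIV \<rightarrow>\<^sub>M subprob_algebra (count_space UNIV)"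
      by (auto simp: space_subprob_algebra prob_space_imp_subprob_space prob_space_measure_pmf)
    moreover have "(\<lambda>\<omega>. \<omega> s) \<in> Pi\<^sub>M {0..<i} (\<lambda>_. count_space UNIV) \<rightarrow>\<^sub>M count_space UNIV"
      using Suc by (intro measurable_component_singleton) simp
    ultimately show ?thesis
      using Suc by (simp add: walk_kernel_def[abs_def] measurable_compose)
  qed
  show "prob_space (walk_kernel E w x i \<omega>)" for \<omega>
    by (simp add: walk_kernel_def prob_space_return prob_space_measure_pmf split: nat.split)
qed

lemma sets_walk_law: "sets (walk_law E w x) = sets (\<Pi>\<^sub>M t\<in>UNIV. count_space UNIV)"
proof -
  interpret Ionescu_Tulcea "walk_kernel E w x" "\<lambda>_. count_space UNIV"
    by (rule walk_Ionescu_Tulcea)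
  show ?thesis unfolding walk_law_def by (rule PF.sets_lim)
qed

theorem emeasure_walk_law_cylinder:
  assumes G: "weighted_graph E w" and con: "edges_connected E"
  shows "emeasure (walk_law E w x) {\<omega>. \<forall>t\<le>n. \<omega> t = p t} =
    ennreal ((if p 0 = x then 1 else 0) * (\<Prod>t<n. transition_matrix E w $ p t $ p (Suc t)))"
proof -
  let ?K = "walk_kernel E w x" and ?M = "\<lambda>_. count_space UNIV" and ?u = "\<lambda>_. undefined"
  interpret Ionescu_Tulcea ?K ?M
    by (rule walk_Ionescu_Tulcea)
  let ?r = "\<lambda>m. restrict p {0..<m}"
  have meas: "{?r m} \<in> sets (Pi\<^sub>M {0..<m} ?M)" for m
  proof -
    have "{?r m} = Pi\<^sub>E {0..<m} (\<lambda>i. {p i})"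
      using PiE_eq_singleton[of "{0..<m}" "\<lambda>i. {p i}" p] by simp
    then show ?thesis by (simp add: sets_PiM_I_finite del: PiE_eq_singleton)
  qed
  have C_cyl: "emeasure (C 0 m ?u) {?r m} = (\<Prod>t<m. emeasure (?K t (?r t)) {p t})" for m
  proof (induction m)
    case 0
    have "?r 0 = ?u" by auto
    then show ?case using meas[of 0] by simp
  next
    case (Suc m)
    have u: "?u \<in> space (Pi\<^sub>M {0..<0} ?M)" by (simp add: space_PiM PiE_def extensional_def)
    have step: "emeasure (eP m \<omega>) {?r (Suc m)}
        = emeasure (?K m (?r m)) {p m} * indicator {?r m} \<omega>"
      if \<omega>: "\<omega> \<in> space (Pi\<^sub>M {0..<m} ?M)" for \<omega>
    proof -
      have ext: "\<omega> i = undefined" if "\<not> i < m" for i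
        using \<omega> that by (auto simp: space_PiM PiE_def extensional_def)
      have "fun_upd \<omega> m y = ?r (Suc m) \<longleftrightarrow> \<omega> = ?r m \<and> y = p m" for y
      proof
        assume eq: "fun_upd \<omega> m y = ?r (Suc m)"
        have "\<omega> i = ?r m i" for i
          using fun_cong[OF eq, of i] ext[of i] by (cases "i < m") simp_all
        moreover have "y = p m" using fun_cong[OF eq, of m] by simp
        ultimately show "\<omega> = ?r m \<and> y = p m" by blast
      next
        assume "\<omega> = ?r m \<and> y = p m"
        then show "fun_upd \<omega> m y = ?r (Suc m)"
          by (simp add: fun_eq_iff less_Suc_eq)
      qed
      then have "(\<lambda>y. fun_upd \<omega> m y) -` {?r (Suc m)} = (if \<omega> = ?r m then {p m} else {})"
        by (simp add: vimage_def)
      then show ?thesis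
        using emeasure_eP[OF \<omega> meas[of "Suc m"]] by (simp add: indicator_def)
    qed
    have "emeasure (C 0 (Suc m) ?u) {?r (Suc m)}
        = (\<integral>\<^sup>+\<omega>. emeasure (eP m \<omega>) {?r (Suc m)} \<partial>C 0 m ?u)"
      using meas[of "Suc m"] measurable_eP[of m] space_C[OF u, of m] sets_C[OF u, of m]
      by (simp add: emeasure_bind[where N="Pi\<^sub>M {0..<Suc m} ?M"] space_PiM_empty_iff
          cong: measurable_cong_sets)
    also have "\<dots> = (\<integral>\<^sup>+\<omega>. emeasure (?K m (?r m)) {p m} * indicator {?r m} \<omega> \<partial>C 0 m ?u)"
      using space_C[OF u, of m] by (intro nn_integral_cong step) simp
    also have "\<dots> = emeasure (?K m (?r m)) {p m} * emeasure (C 0 m ?u) {?r m}"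
      using meas[of m] sets_C[OF u, of m] by (intro nn_integral_cmult_indicator) simp
    finally show ?case unfolding Suc.IH by (simp only: prod.lessThan_Suc mult.commute)
  qed
  have "{\<omega>. \<forall>t\<le>n. \<omega> t = p t} = PF.emb UNIV {0..<Suc n} {?r (Suc n)}"
    by (auto simp: prod_emb_def space_PiM fun_eq_iff less_Suc_eq_le restrict_def) metis
  then have "emeasure (walk_law E w x) {\<omega>. \<forall>t\<le>n. \<omega> t = p t}
      = emeasure PF.lim (PF.emb UNIV {0..<Suc n} {?r (Suc n)})"
    by (simp add: walk_law_def)
  also have "\<dots> = emeasure (CI {0..<Suc n}) {?r (Suc n)}"
    by (intro lim meas) simp
  also have "\<dots> = emeasure (C 0 (Suc n) ?u) (PF.emb {0..<Suc n} {0..<Suc n} {?r (Suc n)})"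
    by (intro emeasure_CI meas) simp
  also have "\<dots> = emeasure (C 0 (Suc n) ?u) {?r (Suc n)}"
    using meas[of "Suc n"] by (subst prod_emb_id) (auto dest: sets.sets_into_space simp: space_PiM)
  also have "\<dots> = (\<Prod>t<Suc n. emeasure (?K t (?r t)) {p t})"
    by (rule C_cyl)
  also have "\<dots> = emeasure (?K 0 (?r 0)) {p 0} * (\<Prod>t<n. emeasure (?K (Suc t) (?r (Suc t))) {p (Suc t)})"
    by (rule prod.lessThan_Suc_shift)
  also have "emeasure (?K 0 (?r 0)) {p 0} = ennreal (if p 0 = x then 1 else 0)"
    by (simp add: walk_kernel_def indicator_def)
  also have "(\<Prod>t<n. emeasure (?K (Suc t) (?r (Suc t))) {p (Suc t)})
      = (\<Prod>t<n. ennreal (transition_matrix E w $ p t $ p (Suc t)))"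
    by (intro prod.cong refl)
      (simp add: walk_kernel_def emeasure_pmf_single pmf_step_pmf[OF G con])
  also have "\<dots> = ennreal (\<Prod>t<n. transition_matrix E w $ p t $ p (Suc t))"
    by (intro prod_ennreal) (metis pmf_nonneg pmf_step_pmf[OF G con])
  also have "ennreal (if p 0 = x then 1 else 0) * \<dots> =
      ennreal ((if p 0 = x then 1 else 0) * (\<Prod>t<n. transition_matrix E w $ p t $ p (Suc t)))"
    by simp
  finally show ?thesis .
qed

end

theory Submission
  imports Defs
begin

text \<open>
  Everything is reduced to a potential \<open>u\<close> with \<open>L u = \<mu> - \<nu>\<close>, for which the resistance is
  \<open>u \<bullet> (\<mu> - \<nu>) = u \<bullet> L u\<close>. The gradient flow of \<open>u\<close> is optimal in the Beckmann problem by
  completing the square; applied at each time, the same square gives the Benamou--Brenier formula, and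
  Cauchy--Schwarz for the Dirichlet form gives the Sobolev norm.

  For the forest formula, put \<open>g = \<mu> - \<nu>\<close> and let \<open>F\<^sub>x\<close> be the component of \<open>x\<close> in a spanning
  2-forest \<open>F\<close>. Then \<open>\<phi>(x) = (1 / (2 \<T>)) \<Sum>\<^sub>F w\<^sub>F g(F\<^sub>x)\<close> is an explicit
  potential: exchanging pairs of a 2-forest and an edge joining its components with pairs of a
  spanning tree and one of its edges turns \<open>L \<phi>\<close> into the average over spanning trees of
  the divergence of the unique tree flow with source \<open>g\<close>.

  For the hitting time formula, the first step equations say \<open>L H(\<cdot>, y) = d - Vol \<delta>\<^sub>y\<close>.
\<close>

subsection \<open>The Laplacian of a connected graph\<close>

lemma matrix_mult_rdistrib:
  fixes A B :: "real^'n^'m" and C :: "real^'k^'n"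
  shows "(A + B) ** C = A ** C + B ** C" and "(A - B) ** C = A ** C - B ** C"
  by (simp_all add: vec_eq_iff matrix_matrix_mult_def algebra_simps sum.distrib sum_subtractf)

lemma matrix_mult_ldistrib_diff:
  fixes A :: "real^'n^'m" and B C :: "real^'k^'n"
  shows "A ** (B - C) = A ** B - A ** C"
  by (simp add: vec_eq_iff matrix_matrix_mult_def algebra_simps sum_subtractf)

lemma orientation_edge: "orientation E E' \<Longrightarrow> e \<in> E' \<Longrightarrow> {fst e, snd e} \<in> E"
  by (auto simp: orientation_def)

locale connected_graph =
  fixes E :: "'v::finite set set" and w :: "'v set \<Rightarrow> real"
  assumes G: "weighted_graph E w" and con: "edges_connected E"
begin

abbreviation "L \<equiv> laplacian E w"

lemma no_loop: "{x, x} \<notin> E"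
  using G unfolding weighted_graph_def by (metis doubleton_eq_iff insert_absorb2)

lemma edge_pair: "e \<in> E \<Longrightarrow> \<exists>x y. e = {x, y}"
  using G unfolding weighted_graph_def by blast

lemma laplacian_mult: "(L *v f) $ x = (\<Sum>y | {x, y} \<in> E. w {x, y} * (f $ x - f $ y))"
proof -
  have 1: "(degree_matrix E w *v f) $ x = deg E w x * f $ x"
    by (simp add: degree_matrix_def matrix_vector_mult_def if_distrib[of "\<lambda>a. a * _"] cong: if_cong)
  have 2: "(adjacency_matrix E w *v f) $ x = (\<Sum>y | {x, y} \<in> E. w {x, y} * f $ y)"
    by (simp add: adjacency_matrix_def matrix_vector_mult_def if_distrib[of "\<lambda>a. a * _"]
        sum.If_cases cong: if_cong)
  show ?thesis
    by (simp add: laplacian_def matrix_vector_mult_diff_rdistrib 1 2 deg_def right_diff_distrib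
        sum_subtractf sum_distrib_right)
qed

text \<open>Picks one ordered pair of endpoints for each edge. Facts about \<open>L\<close> that
  mention no orientation are still proved through the Dirichlet form as a sum over oriented
  edges.\<close>

lemma orientation_exists: "\<exists>E'. orientation E E'"
proof -
  define c where "c e = (SOME p. e = {fst p, snd p})" for e :: "'v set"
  have c: "e = {fst (c e), snd (c e)}" if "e \<in> E" for e
  proof -
    from edge_pair[OF that] obtain x y where "e = {fst (x, y), snd (x, y)}" by auto
    then show ?thesis unfolding c_def by (rule someI)
  qed
  have "orientation E (c ` E)"
    unfolding orientation_def
  proof (intro conjI allI impI)
    show "\<forall>(x, y)\<in>c ` E. {x, y} \<in> E"
      using c by (auto simp: split_beta)
    fix x y assume xy: "{x, y} \<in> E"
    have ne: "x \<noteq> y" using xy no_loop by auto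
    have "c {x, y} = (x, y) \<or> c {x, y} = (y, x)"
      using c[OF xy] by (auto simp: doubleton_eq_iff prod_eq_iff)
    moreover have e: "e = {x, y}" if "e \<in> E" "c e = (x, y) \<or> c e = (y, x)" for e
      using c[OF that(1)] that(2) by (metis fst_conv snd_conv insert_commute)
    moreover have "(x, y) \<noteq> (y, x)" using ne by simp
    moreover have "c {x, y} \<in> c ` E" using xy by (rule imageI)
    moreover have "p = c {x, y}" if "p \<in> c ` E" "p = (x, y) \<or> p = (y, x)" for p
      using that e by auto
    ultimately show "((x, y) \<in> c ` E) \<noteq> ((y, x) \<in> c ` E)"
      by metis
  qed
  then show ?thesis by blast
qed

lemma orientation_ne: "orientation E E' \<Longrightarrow> e \<in> E' \<Longrightarrow> fst e \<noteq> snd e"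
  using orientation_edge no_loop by metis

lemma oriented_weight_pos: "orientation E E' \<Longrightarrow> e \<in> E' \<Longrightarrow> 0 < oriented_weight w e"
  unfolding oriented_weight_def using orientation_edge weight_pos[OF G] by blast

text \<open>Summation by parts: a column of the incidence matrix is nonzero only at the two ends of
  its edge, so its transpose is the discrete gradient.\<close>

lemma inner_incidence_mult:
  assumes "orientation E E'"
  shows "f \<bullet> incidence_mult E' J = (\<Sum>e\<in>E'. J e * (f $ fst e - f $ snd e))"
proof -
  have "f \<bullet> incidence_mult E' J = (\<Sum>e\<in>E'. \<Sum>x\<in>UNIV. f $ x * (incidence x e * J e))"
    by (simp add: inner_vec_def incidence_mult_def sum_distrib_left sum.swap[of _ E'])
  also have "\<dots> = (\<Sum>e\<in>E'. J e * (f $ fst e - f $ snd e))"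
  proof (rule sum.cong[OF refl])
    fix e assume e: "e \<in> E'"
    have "(\<Sum>x\<in>UNIV. f $ x * (incidence x e * J e))
      = (\<Sum>x\<in>UNIV. (if x = fst e then f $ x * J e else 0) + (if x = snd e then - f $ x * J e else 0))"
      using orientation_ne[OF assms e] by (intro sum.cong) (auto simp: incidence_def)
    then show "(\<Sum>x\<in>UNIV. f $ x * (incidence x e * J e)) = J e * (f $ fst e - f $ snd e)"
      by (simp add: sum.distrib algebra_simps)
  qed
  finally show ?thesis .
qed

text \<open>For an edge entering \<open>x\<close> both the incidence sign and the difference of
  \<open>f\<close> are reversed, so incoming and outgoing edges contribute alike and the orientation
  drops out. This is the factorization of \<open>L\<close> as divergence after weighted
  gradient.\<close>

lemma incidence_gradient:
  assumes o: "orientation E E'"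
  shows "incidence_mult E' (\<lambda>e. oriented_weight w e * (f $ fst e - f $ snd e)) = L *v f"
proof (rule vec_eq_iff[THEN iffD2], rule allI)
  fix x
  let ?J = "\<lambda>e. oriented_weight w e * (f $ fst e - f $ snd e)"
  let ?t = "\<lambda>y. w {x, y} * (f $ x - f $ y)"
  let ?O = "{y. (x, y) \<in> E'}" and ?I = "{y. (y, x) \<in> E'}"
  have nl: "(x, x) \<notin> E'" using orientation_ne[OF o] by force
  have "(incidence_mult E' ?J) $ x = (\<Sum>e\<in>E'. incidence x e * ?J e)"
    by (simp add: incidence_mult_def)
  also have "\<dots> = (\<Sum>e\<in>Pair x ` ?O \<union> (\<lambda>y. (y, x)) ` ?I. incidence x e * ?J e)"
    by (rule sum.mono_neutral_right) (auto simp: incidence_def)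
  also have "\<dots> = (\<Sum>e\<in>Pair x ` ?O. incidence x e * ?J e)
      + (\<Sum>e\<in>(\<lambda>y. (y, x)) ` ?I. incidence x e * ?J e)"
    using nl by (intro sum.union_disjoint) auto
  also have "(\<Sum>e\<in>Pair x ` ?O. incidence x e * ?J e) = (\<Sum>y\<in>?O. ?t y)"
    by (subst sum.reindex) (auto simp: inj_on_def incidence_def oriented_weight_def)
  also have "(\<Sum>e\<in>(\<lambda>y. (y, x)) ` ?I. incidence x e * ?J e) = (\<Sum>y\<in>?I. ?t y)"
    using nl by (subst sum.reindex)
      (auto simp: inj_on_def incidence_def oriented_weight_def insert_commute algebra_simps
        intro!: sum.cong)
  also have "(\<Sum>y\<in>?O. ?t y) + (\<Sum>y\<in>?I. ?t y) = (\<Sum>y\<in>?O \<union> ?I. ?t y)"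
  proof (rule sum.union_disjoint[symmetric])
    have "(y, x) \<notin> E'" if "(x, y) \<in> E'" for y
      using o that orientation_edge[OF o that] unfolding orientation_def by auto
    then show "?O \<inter> ?I = {}" by auto
  qed auto
  also have "?O \<union> ?I = {y. {x, y} \<in> E}"
  proof (rule set_eqI)
    fix y
    have "(x, y) \<in> E' \<Longrightarrow> {x, y} \<in> E" "(y, x) \<in> E' \<Longrightarrow> {x, y} \<in> E"
      using orientation_edge[OF o, of "(x, y)"] orientation_edge[OF o, of "(y, x)"]
      by (simp_all add: insert_commute)
    moreover have "{x, y} \<in> E \<Longrightarrow> (x, y) \<in> E' \<or> (y, x) \<in> E'"
      using o unfolding orientation_def by blast
    ultimately show "y \<in> ?O \<union> ?I \<longleftrightarrow> y \<in> {y. {x, y} \<in> E}" by blast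
  qed
  finally show "(incidence_mult E' ?J) $ x = (L *v f) $ x"
    by (simp add: laplacian_mult)
qed

lemma dirichlet_form:
  assumes "orientation E E'"
  shows "f \<bullet> (L *v h) =
    (\<Sum>e\<in>E'. oriented_weight w e * (f $ fst e - f $ snd e) * (h $ fst e - h $ snd e))"
  by (simp add: incidence_gradient[OF assms, symmetric] inner_incidence_mult[OF assms] ac_simps)

lemma laplacian_sym: "f \<bullet> (L *v h) = (L *v f) \<bullet> h"
proof -
  obtain E' where o: "orientation E E'" using orientation_exists by blast
  show ?thesis
    by (simp add: inner_commute[of "L *v f"] dirichlet_form[OF o] mult.commute mult.left_commute)
qed

text \<open>Forgetting directions maps an orientation bijectively onto \<open>E\<close>, and squares
  do not see the sign of a difference.\<close>

lemma H1_norm_sq_eq: "H1_norm_sq E w f = f \<bullet> (L *v f)"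
proof -
  obtain E' where o: "orientation E E'" using orientation_exists by blast
  have inj: "inj_on (\<lambda>e. {fst e, snd e}) E'"
  proof (rule inj_onI)
    fix p q assume p: "p \<in> E'" and q: "q \<in> E'" and eq: "{fst p, snd p} = {fst q, snd q}"
    have "\<not> ((fst p, snd p) \<in> E' \<and> (snd p, fst p) \<in> E')"
      using o orientation_edge[OF o p] unfolding orientation_def by blast
    then have "q \<noteq> (snd p, fst p)" using p q by auto
    then show "p = q" using eq by (auto simp: doubleton_eq_iff prod_eq_iff)
  qed
  have im: "(\<lambda>e. {fst e, snd e}) ` E' = E"
  proof
    show "(\<lambda>e. {fst e, snd e}) ` E' \<subseteq> E" using orientation_edge[OF o] by blast
    show "E \<subseteq> (\<lambda>e. {fst e, snd e}) ` E'"
    proof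
      fix e assume e: "e \<in> E"
      then obtain x y where xy: "e = {x, y}" using edge_pair by blast
      then have "(x, y) \<in> E' \<or> (y, x) \<in> E'"
        using o e unfolding orientation_def by blast
      then show "e \<in> (\<lambda>e. {fst e, snd e}) ` E'"
        using xy by (force simp: insert_commute)
    qed
  qed
  have "H1_norm_sq E w f = (\<Sum>e\<in>E'. w {fst e, snd e} * (edge_diff f {fst e, snd e})\<^sup>2)"
    unfolding H1_norm_sq_def im[symmetric] by (simp add: sum.reindex[OF inj])
  then show ?thesis
    by (simp add: dirichlet_form[OF o] edge_diff_pair oriented_weight_def power2_eq_square mult.assoc)
qed

lemma laplacian_nonneg: "0 \<le> f \<bullet> (L *v f)"
  unfolding H1_norm_sq_eq[symmetric] H1_norm_sq_def
  using weight_pos[OF G] by (intro sum_nonneg) (simp add: less_imp_le)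

text \<open>A vanishing sum of nonnegative terms vanishes termwise, so \<open>f\<close> agrees
  across each edge; connectivity spreads this to all vertices.\<close>

lemma dirichlet_zero_const:
  assumes "f \<bullet> (L *v f) = 0"
  shows "f $ x = f $ y"
proof -
  have nn: "0 \<le> w e * (edge_diff f e)\<^sup>2" if "e \<in> E" for e
    using weight_pos[OF G that] by simp
  have z: "w e * (edge_diff f e)\<^sup>2 = 0" if "e \<in> E" for e
    using assms that nn unfolding H1_norm_sq_eq[symmetric] H1_norm_sq_def
    by (subst (asm) sum_nonneg_eq_0_iff) auto
  have edge: "f $ a = f $ b" if "(a, b) \<in> adj_rel E" for a b
  proof -
    have "{a, b} \<in> E" using that by (simp add: adj_rel_def)
    then show ?thesis using z[of "{a, b}"] weight_pos[OF G, of "{a, b}"] by (simp add: edge_diff_pair)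
  qed
  have "(x, y) \<in> (adj_rel E)\<^sup>*" using con by (simp add: edges_connected_def)
  then show ?thesis by (induction rule: rtrancl_induct) (auto dest: edge)
qed

section \<open>Kernel, range and Moore--Penrose inverse of the Laplacian\<close>

lemma laplacian_const: "(\<And>x. f $ x = c) \<Longrightarrow> L *v f = 0"
  by (simp add: vec_eq_iff laplacian_mult)

lemma sum_laplacian: "(\<Sum>x\<in>UNIV. (L *v f) $ x) = 0"
proof -
  have "(\<Sum>x\<in>UNIV. (L *v f) $ x) = (\<chi> x. 1) \<bullet> (L *v f)"
    by (simp add: inner_vec_def)
  also have "\<dots> = 0"
    by (subst laplacian_sym, subst laplacian_const[of _ 1]) auto
  finally show ?thesis .
qed

text \<open>The orthogonal projection onto the constant vectors, that is, onto the kernel of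
  \<open>L\<close>.\<close>

definition avg :: "real^'v^'v" where
  "avg = (\<chi> x y. 1 / real CARD('v))"

lemma avg_mult: "(avg *v f) $ x = (\<Sum>y\<in>UNIV. f $ y) / real CARD('v)"
  by (simp add: avg_def matrix_vector_mult_def sum_divide_distrib)

lemma transpose_laplacian: "transpose L = L"
  by (simp add: vec_eq_iff transpose_def laplacian_def degree_matrix_def adjacency_matrix_def
      insert_commute)

lemma transpose_avg: "transpose avg = avg"
  by (simp add: vec_eq_iff transpose_def avg_def)

lemma avg_idem: "avg ** avg = avg"
  by (simp add: vec_eq_iff matrix_matrix_mult_def avg_def)

lemma laplacian_avg: "L ** avg = 0"
  by (subst matrix_eq) (auto simp: matrix_vector_mul_assoc[symmetric] avg_mult intro!: laplacian_const)

lemma avg_laplacian: "avg ** L = 0"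
  using arg_cong[OF laplacian_avg, of transpose]
  by (simp add: matrix_transpose_mul transpose_avg transpose_laplacian)
     (simp add: transpose_def vec_eq_iff)

text \<open>Both summands are positive semidefinite. A kernel vector therefore has zero Dirichlet
  form, hence is constant, and zero sum, hence is 0.\<close>

lemma laplacian_avg_inverse: "\<exists>Y. Y ** (L + avg) = mat 1 \<and> (L + avg) ** Y = mat 1"
proof -
  have "f = 0" if 0: "(L + avg) *v f = 0" for f
  proof -
    let ?s = "\<Sum>y\<in>UNIV. f $ y"
    have "0 = f \<bullet> ((L + avg) *v f)" by (simp add: 0)
    also have "\<dots> = f \<bullet> (L *v f) + f \<bullet> (avg *v f)"
      by (simp add: matrix_vector_mult_add_rdistrib inner_add_right)
    also have "f \<bullet> (avg *v f) = ?s\<^sup>2 / real CARD('v)"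
      by (simp add: inner_vec_def avg_mult sum_distrib_right[symmetric] sum_divide_distrib[symmetric]
          power2_eq_square)
    finally have eq: "f \<bullet> (L *v f) + ?s\<^sup>2 / real CARD('v) = 0" by simp
    have nn: "0 \<le> ?s\<^sup>2 / real CARD('v)" by simp
    have "f \<bullet> (L *v f) = 0" using eq nn laplacian_nonneg[of f] by linarith
    moreover from this have "?s = 0" using eq by simp
    ultimately have "f $ x = 0" for x
    proof -
      have "?s = (\<Sum>y\<in>(UNIV::'v set). f $ x)"
        using dirichlet_zero_const \<open>f \<bullet> (L *v f) = 0\<close> by (intro sum.cong) auto
      then show ?thesis using \<open>?s = 0\<close> by simp
    qed
    then show ?thesis by (simp add: vec_eq_iff)
  qed
  then obtain Y where "Y ** (L + avg) = mat 1"
    using matrix_left_invertible_ker by blast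
  then show ?thesis using matrix_left_right_inverse by blast
qed

text \<open>With \<open>Y\<close> the inverse of \<open>L + avg\<close>, the candidate is
  \<open>Y - avg\<close>: its products with \<open>L\<close> on either side are the symmetric
  projection \<open>mat 1 - avg\<close>. Existence is what gives the \<open>THE\<close> in
  \<open>pseudoinverse\<close> its meaning.\<close>

lemma pseudoinverse_laplacian: "is_pseudoinverse L (pseudoinverse L)"
proof -
  obtain Y where l: "Y ** (L + avg) = mat 1" and r: "(L + avg) ** Y = mat 1"
    using laplacian_avg_inverse by blast
  have MA: "(L + avg) ** avg = avg"
    by (simp add: matrix_mult_rdistrib(1) laplacian_avg avg_idem)
  have AM: "avg ** (L + avg) = avg"
    by (simp add: matrix_add_ldistrib avg_laplacian avg_idem)
  have YA: "Y ** avg = avg" using MA l by (metis matrix_mul_assoc matrix_mul_lid)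
  have AY: "avg ** Y = avg" using AM r by (metis matrix_mul_assoc matrix_mul_rid)
  have LY: "L ** Y = mat 1 - avg"
    using r AY by (simp add: matrix_mult_rdistrib(1) eq_diff_eq)
  have YL: "Y ** L = mat 1 - avg"
    using l YA by (simp add: matrix_add_ldistrib eq_diff_eq)
  let ?X = "Y - avg"
  have LX: "L ** ?X = mat 1 - avg" by (simp add: matrix_mult_ldistrib_diff LY laplacian_avg)
  have XL: "?X ** L = mat 1 - avg" by (simp add: matrix_mult_rdistrib(2) YL avg_laplacian)
  have tr: "transpose (mat 1 - avg) = mat 1 - avg"
    by (auto simp: vec_eq_iff transpose_def avg_def mat_def)
  have "is_pseudoinverse L ?X"
    unfolding is_pseudoinverse_def LX XL tr
    by (simp add: matrix_mult_rdistrib(2) matrix_mult_ldistrib_diff avg_laplacian AY avg_idem)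
  then show ?thesis
    unfolding pseudoinverse_def by (rule theI) (rule is_pseudoinverse_unique[OF _ \<open>is_pseudoinverse L ?X\<close>])
qed

text \<open>Inverting \<open>L + avg\<close> gives the solution: applying \<open>avg\<close> to the
  equation shows that the \<open>avg\<close> part of it is the mean of \<open>g\<close>, which is
  0.\<close>

lemma laplacian_solvable:
  assumes "(\<Sum>x\<in>UNIV. g $ x) = 0"
  shows "\<exists>f. L *v f = g"
proof -
  obtain Y where r: "(L + avg) ** Y = mat 1"
    using laplacian_avg_inverse by blast
  let ?f = "Y *v g"
  have eq: "L *v ?f + avg *v ?f = g"
    using r by (metis matrix_vector_mul_assoc matrix_vector_mul_lid matrix_vector_mult_add_rdistrib)
  have "avg *v g = avg *v (L *v ?f) + avg *v (avg *v ?f)"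
    by (metis eq matrix_vector_right_distrib)
  also have "avg *v (L *v ?f) = 0"
    unfolding matrix_vector_mul_assoc[of avg L] avg_laplacian by simp
  also have "avg *v (avg *v ?f) = avg *v ?f"
    unfolding matrix_vector_mul_assoc[of avg avg] avg_idem by simp
  finally have "avg *v g = avg *v ?f" by simp
  moreover have "avg *v g = 0" by (simp add: vec_eq_iff avg_mult assms)
  ultimately show ?thesis using eq by auto
qed

text \<open>Follows from the symmetry of \<open>L\<close> and the first Penrose equation. The
  potential is arbitrary, so each formula may bring its own.\<close>

lemma resistance_eq_inner:
  assumes f: "L *v f = \<mu> - \<nu>"
  shows "resistance E w \<mu> \<nu> = f \<bullet> (\<mu> - \<nu>)"
proof -
  let ?P = "pseudoinverse L"
  have "resistance E w \<mu> \<nu> = (L *v f) \<bullet> (?P *v (L *v f))"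
    by (simp add: resistance_def f)
  also have "\<dots> = f \<bullet> (L *v (?P *v (L *v f)))" by (simp add: laplacian_sym)
  also have "L *v (?P *v (L *v f)) = L *v f"
    using pseudoinverse_laplacian by (simp add: is_pseudoinverse_def matrix_vector_mul_assoc matrix_mul_assoc)
  finally show ?thesis by (simp add: f)
qed

subsection \<open>Flows and Sobolev norms\<close>

context
  fixes E' :: "('v \<times> 'v) set" and u g :: "real^'v"
  assumes o: "orientation E E'" and u: "L *v u = g"
begin

text \<open>Ohm's law: conductance times potential difference. The restriction places it among the
  functions determined by their values on \<open>E'\<close>, as the Beckmann problem and the product
  measurable space require.\<close>

definition gradient_flow :: "'v \<times> 'v \<Rightarrow> real" where
  "gradient_flow = restrict (\<lambda>e. oriented_weight w e * (u $ fst e - u $ snd e)) E'"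

lemma incidence_gradient_flow: "incidence_mult E' gradient_flow = g"
proof -
  have "incidence_mult E' gradient_flow
      = incidence_mult E' (\<lambda>e. oriented_weight w e * (u $ fst e - u $ snd e))"
    by (simp add: incidence_mult_def gradient_flow_def)
  then show ?thesis using incidence_gradient[OF o] u by simp
qed

lemma flow_energy_gradient_flow: "flow_energy w E' gradient_flow = u \<bullet> g"
proof -
  have "flow_energy w E' gradient_flow = u \<bullet> (L *v u)"
    unfolding flow_energy_def dirichlet_form[OF o]
    using oriented_weight_pos[OF o]
    by (intro sum.cong) (simp_all add: gradient_flow_def power2_eq_square less_imp_neq[symmetric])
  then show ?thesis by (simp add: u)
qed

text \<open>Expands the weighted square of the distance from \<open>J\<close> to the gradient flow.
  It holds for every \<open>J\<close>, so it can be used both for competitors with divergence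
  \<open>g\<close> and at each time of a path.\<close>

lemma flow_energy_lower:
  "2 * (u \<bullet> incidence_mult E' J) - u \<bullet> g \<le> flow_energy w E' J"
proof -
  let ?d = "\<lambda>e. u $ fst e - u $ snd e" and ?w = "oriented_weight w"
  have "2 * (u \<bullet> incidence_mult E' J) - u \<bullet> (L *v u)
      = (\<Sum>e\<in>E'. 2 * (J e * ?d e) - ?w e * ?d e * ?d e)"
    by (simp add: inner_incidence_mult[OF o] dirichlet_form[OF o] sum_subtractf sum_distrib_left)
  also have "\<dots> \<le> flow_energy w E' J"
    unfolding flow_energy_def
  proof (rule sum_mono)
    fix e assume "e \<in> E'"
    then have p: "0 < ?w e" by (rule oriented_weight_pos[OF o])
    have "0 \<le> (J e - ?w e * ?d e)\<^sup>2 / ?w e" using p by simp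
    also have "\<dots> = \<bar>J e\<bar>\<^sup>2 / ?w e - (2 * (J e * ?d e) - ?w e * ?d e * ?d e)"
      using p by (simp add: field_simps power2_eq_square)
    finally show "2 * (J e * ?d e) - ?w e * ?d e * ?d e \<le> \<bar>J e\<bar>\<^sup>2 / ?w e" by simp
  qed
  finally show ?thesis by (simp add: u)
qed

lemma beckmann:
  "ereal (u \<bullet> g) = Inf {ereal (flow_energy w E' J) | J. J \<in> E' \<rightarrow>\<^sub>E UNIV \<and> incidence_mult E' J = g}"
proof (rule antisym)
  show "ereal (u \<bullet> g) \<le> Inf {ereal (flow_energy w E' J) | J. J \<in> E' \<rightarrow>\<^sub>E UNIV \<and> incidence_mult E' J = g}"
  proof (rule Inf_greatest, clarify)
    fix J assume "g = incidence_mult E' J"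
    then show "ereal (u \<bullet> incidence_mult E' J) \<le> ereal (flow_energy w E' J)"
      using flow_energy_lower[of J] by simp
  qed
  show "Inf {ereal (flow_energy w E' J) | J. J \<in> E' \<rightarrow>\<^sub>E UNIV \<and> incidence_mult E' J = g} \<le> ereal (u \<bullet> g)"
    using incidence_gradient_flow flow_energy_gradient_flow
    by (intro Inf_lower CollectI exI[of _ gradient_flow]) (auto simp: gradient_flow_def)
qed

text \<open>The pointwise bound is affine in the velocity of \<rho>, so its time integral depends
  only on the endpoints and equals \<open>u \<bullet> g\<close>.\<close>

lemma path_action_lower:
  assumes adm: "admissible_path E' \<mu> \<nu> \<rho> J" and g: "g = \<mu> - \<nu>"
  shows "ereal (u \<bullet> g) \<le> path_action w E' J"
proof -
  let ?I = "{0..1::real}"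
  define d where "d t = vector_derivative \<rho> (at t within ?I)" for t
  \<comment> \<open>The left side of \<open>flow_energy_lower\<close> with the divergence of
    \<open>J t\<close> replaced by \<open>- d t\<close>. This makes it continuous in
    \<open>t\<close>, although \<open>J\<close> is only Borel.\<close>
  define h where "h t = - 2 * (u \<bullet> d t) - u \<bullet> g" for t
  have der: "(\<rho> has_vector_derivative d t) (at t within ?I)" if "t \<in> ?I" for t
    using adm that by (simp add: admissible_path_def C1_unit_interval_def d_def vector_derivative_works)
  have cont: "continuous_on ?I h"
    using adm unfolding h_def d_def admissible_path_def C1_unit_interval_def
    by (intro continuous_intros) auto
  have "((\<lambda>t. - 2 * (u \<bullet> \<rho> t) - t * (u \<bullet> g)) has_vector_derivative h t) (at t within ?I)"
    if "t \<in> ?I" for t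
    unfolding h_def
    by (rule derivative_eq_intros bounded_linear.has_vector_derivative[OF bounded_linear_inner_right]
        der[OF that] refl | simp)+
  then have "(h has_integral ((- 2 * (u \<bullet> \<rho> 1) - 1 * (u \<bullet> g)) - (- 2 * (u \<bullet> \<rho> 0) - 0 * (u \<bullet> g)))) ?I"
    by (intro fundamental_theorem_of_calculus) auto
  moreover have "(- 2 * (u \<bullet> \<rho> 1) - 1 * (u \<bullet> g)) - (- 2 * (u \<bullet> \<rho> 0) - 0 * (u \<bullet> g)) = u \<bullet> g"
    using adm by (simp add: admissible_path_def g inner_diff_right algebra_simps)
  ultimately have hi: "(h has_integral u \<bullet> g) ?I" by (simp only:)
  have si: "set_integrable lborel ?I h"
    by (rule borel_integrable_atLeastAtMost') (rule cont)
  have "(LINT t:?I|lborel. h t) = u \<bullet> g"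
    using set_borel_integral_eq_integral(2)[OF si] integral_unique[OF hi] by simp
  then have "ennreal (u \<bullet> g) = ennreal (LINT t|lborel. indicator ?I t * h t)"
    by (simp add: set_lebesgue_integral_def)
  \<comment> \<open>\<open>h\<close> may take negative values, which \<open>ennreal\<close>
    truncates to 0, so passing to the nonnegative integral can only increase the value.\<close>
  also have "\<dots> \<le> (\<integral>\<^sup>+t. ennreal (indicator ?I t * h t) \<partial>lborel)"
  proof -
    have "integrable lborel (\<lambda>t. indicator ?I t * h t)"
      using si by (simp add: set_integrable_def)
    then have "ennreal (LINT t|lborel. indicator ?I t * h t)
        \<le> ennreal (LINT t|lborel. max 0 (indicator ?I t * h t))"
      by (intro ennreal_leI integral_mono) auto
    also have "\<dots> = (\<integral>\<^sup>+t. ennreal (max 0 (indicator ?I t * h t)) \<partial>lborel)"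
      using \<open>integrable lborel (\<lambda>t. indicator ?I t * h t)\<close>
      by (intro nn_integral_eq_integral[symmetric]) auto
    also have "\<dots> = (\<integral>\<^sup>+t. ennreal (indicator ?I t * h t) \<partial>lborel)"
      by (intro nn_integral_cong) (metis ennreal_neg ennreal_0 max_def linorder_linear)
    finally show ?thesis .
  qed
  also have "\<dots> \<le> (\<integral>\<^sup>+t\<in>?I. ennreal (flow_energy w E' (J t)) \<partial>lborel)"
  proof (intro nn_integral_mono)
    fix t
    show "ennreal (indicator ?I t * h t) \<le> ennreal (flow_energy w E' (J t)) * indicator ?I t"
    proof (cases "t \<in> ?I")
      case True
      then have "d t = - incidence_mult E' (J t)"
        using adm by (simp add: admissible_path_def d_def eq_neg_iff_add_eq_0)
      then have "h t \<le> flow_energy w E' (J t)"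
        using flow_energy_lower[of "J t"] by (simp add: h_def)
      then show ?thesis using True by (simp add: ennreal_leI)
    qed simp
  qed
  finally have "ennreal (u \<bullet> g) \<le> (\<integral>\<^sup>+t\<in>?I. ennreal (flow_energy w E' (J t)) \<partial>lborel)" .
  moreover have "0 \<le> u \<bullet> g" using laplacian_nonneg[of u] u by simp
  ultimately show ?thesis
    unfolding path_action_def by (metis enn2ereal_ennreal less_eq_ennreal.rep_eq)
qed

lemma benamou_brenier:
  assumes g: "g = \<mu> - \<nu>"
  shows "ereal (u \<bullet> g) = Inf {path_action w E' J | \<rho> J. admissible_path E' \<mu> \<nu> \<rho> J}"
proof (rule antisym)
  show "ereal (u \<bullet> g) \<le> Inf {path_action w E' J | \<rho> J. admissible_path E' \<mu> \<nu> \<rho> J}"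
    using path_action_lower[OF _ g] by (intro Inf_greatest) blast
  \<comment> \<open>Linear interpolation has constant velocity \<open>- g\<close>, which the
    time-independent gradient flow balances; the action is then its Beckmann energy.\<close>
  let ?\<rho> = "\<lambda>t. \<mu> - t *\<^sub>R g" and ?J = "\<lambda>t::real. gradient_flow"
  have der: "(?\<rho> has_vector_derivative - g) (at t within {0..1})" for t
    by (auto intro!: derivative_eq_intros)
  have vd: "vector_derivative ?\<rho> (at t within {0..1}) = - g" if "t \<in> {0..1}" for t :: real
    using that der[of t] by (intro vector_derivative_within_closed_interval[of 0 1]) auto
  have "admissible_path E' \<mu> \<nu> ?\<rho> ?J"
    unfolding admissible_path_def C1_unit_interval_def
  proof (intro conjI ballI)
    show "?\<rho> differentiable (at t within {0..1})" for t
      using der by (auto simp: has_vector_derivative_def differentiable_def)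
    show "continuous_on {0..1} (\<lambda>t. vector_derivative ?\<rho> (at t within {0..1}))"
      using vd by (subst continuous_on_cong[OF refl, where g="\<lambda>_. - g"]) auto
    show "?J \<in> restrict_space borel {0..1} \<rightarrow>\<^sub>M (\<Pi>\<^sub>M e\<in>E'. borel)"
      by (intro measurable_const) (simp add: space_PiM gradient_flow_def)
    show "vector_derivative ?\<rho> (at t within {0..1}) + incidence_mult E' gradient_flow = 0"
      if "t \<in> {0..1}" for t
      by (simp only: vd[OF that] incidence_gradient_flow) simp
  qed (simp_all add: g)
  moreover have "path_action w E' ?J = ereal (u \<bullet> g)"
  proof -
    have "0 \<le> u \<bullet> g" using laplacian_nonneg[of u] u by simp
    then show ?thesis
      by (simp add: path_action_def flow_energy_gradient_flow nn_integral_cmult_indicator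
          enn2ereal_ennreal)
  qed
  ultimately show "Inf {path_action w E' J | \<rho> J. admissible_path E' \<mu> \<nu> \<rho> J} \<le> ereal (u \<bullet> g)"
    by (intro Inf_lower CollectI) metis
qed

end

section \<open>The dual Sobolev norm\<close>

lemma H1_norm_sq_pos:
  assumes "f \<in> mean_zero - {0}"
  shows "0 < f \<bullet> (L *v f)"
proof (rule ccontr)
  assume "\<not> 0 < f \<bullet> (L *v f)"
  then have "f \<bullet> (L *v f) = 0" using laplacian_nonneg[of f] by simp
  then have "f $ x = f $ y" for x y by (rule dirichlet_zero_const)
  then have "(\<Sum>y\<in>UNIV. f $ y) = (\<Sum>y\<in>(UNIV::'v set). f $ x)" for x by (intro sum.cong) auto
  then have "f $ x = 0" for x using assms by (simp add: mean_zero_def)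
  then show False using assms by (auto simp: vec_eq_iff)
qed

text \<open>The form is only semidefinite. If \<open>f\<close> has zero energy it is constant and
  \<open>L *v f\<close> vanishes; otherwise the quadratic in \<open>s\<close>, \<open>t\<close> is
  evaluated at its critical direction \<open>s = ?b\<close>, \<open>t = ?a\<close>.\<close>

lemma laplacian_cauchy_schwarz:
  "(f \<bullet> (L *v h))\<^sup>2 \<le> (f \<bullet> (L *v f)) * (h \<bullet> (L *v h))"
proof -
  have sym: "h \<bullet> (L *v f) = f \<bullet> (L *v h)" by (metis laplacian_sym inner_commute)
  have quad: "0 \<le> s\<^sup>2 * (f \<bullet> (L *v f)) - 2 * s * t * (f \<bullet> (L *v h)) + t\<^sup>2 * (h \<bullet> (L *v h))" for s t
    using laplacian_nonneg[of "s *\<^sub>R f - t *\<^sub>R h"]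
    by (simp add: matrix_vector_mult_diff_distrib matrix_vector_mult_scaleR inner_diff_left
        inner_diff_right sym power2_eq_square algebra_simps)
  let ?a = "f \<bullet> (L *v f)" and ?b = "f \<bullet> (L *v h)" and ?c = "h \<bullet> (L *v h)"
  show ?thesis
  proof (cases "?a = 0")
    case True
    then have "f $ x = f $ y" for x y by (rule dirichlet_zero_const)
    then have "L *v f = 0" by (intro laplacian_const)
    then have "?b = 0" by (simp add: laplacian_sym)
    then show ?thesis using True by simp
  next
    case False
    then have a: "0 < ?a" using laplacian_nonneg[of f] by simp
    have "0 \<le> ?b\<^sup>2 * ?a - 2 * ?b * ?a * ?b + ?a\<^sup>2 * ?c" by (rule quad)
    also have "\<dots> = ?a * (?a * ?c - ?b\<^sup>2)" by (simp add: power2_eq_square algebra_simps)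
    finally show ?thesis using a by (simp add: zero_le_mult_iff)
  qed
qed

text \<open>Keeps the supremum in \<open>Hneg1_norm_sq\<close> from running over the empty set,
  where it would be \<open>- \<infinity>\<close>. An edge supplies the two vertices.\<close>

lemma mean_zero_nontrivial: "mean_zero - {0} \<noteq> ({} :: (real^'v) set)"
proof -
  obtain x y :: 'v where xy: "x \<noteq> y" using G no_loop edge_pair unfolding weighted_graph_def
    by (metis ex_in_conv)
  let ?f = "axis x 1 - axis y 1 :: real^'v"
  have "(\<Sum>z\<in>UNIV. ?f $ z) = 0" by (simp add: axis_def sum_subtractf)
  moreover have "?f $ x = 1" using xy by (simp add: axis_def)
  then have "?f \<noteq> 0" by (metis zero_index zero_neq_one)
  ultimately have "?f \<in> mean_zero - {0}" by (simp add: mean_zero_def)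
  then show ?thesis by blast
qed

text \<open>Cauchy--Schwarz against \<open>u\<close> bounds every quotient. The bound is attained by
  \<open>u\<close> minus its mean, unless \<open>u \<bullet> g = 0\<close>, when any test vector
  serves because quotients are nonnegative.\<close>

lemma Hneg1_norm_sq_eq:
  assumes u: "L *v u = g"
  shows "ereal (u \<bullet> g) = Hneg1_norm_sq E w g"
proof (rule antisym)
  have nn: "0 \<le> u \<bullet> g" using laplacian_nonneg[of u] u by simp
  show "Hneg1_norm_sq E w g \<le> ereal (u \<bullet> g)"
    unfolding Hneg1_norm_sq_def
  proof (rule SUP_least)
    fix f :: "real^'v" assume f: "f \<in> mean_zero - {0}"
    then show "ereal ((f \<bullet> g)\<^sup>2 / H1_norm_sq E w f) \<le> ereal (u \<bullet> g)"
      using laplacian_cauchy_schwarz[of f u] H1_norm_sq_pos[OF f]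
      by (simp add: u H1_norm_sq_eq pos_divide_le_eq mult.commute)
  qed
  show "ereal (u \<bullet> g) \<le> Hneg1_norm_sq E w g"
  proof (cases "u \<bullet> g = 0")
    case True
    obtain f :: "real^'v" where f: "f \<in> mean_zero - {0}" using mean_zero_nontrivial by blast
    have "ereal (u \<bullet> g) \<le> ereal ((f \<bullet> g)\<^sup>2 / H1_norm_sq E w f)"
      using True H1_norm_sq_pos[OF f] by (simp add: H1_norm_sq_eq)
    also have "\<dots> \<le> Hneg1_norm_sq E w g"
      unfolding Hneg1_norm_sq_def using f by (rule SUP_upper)
    finally show ?thesis .
  next
    case False
    define f where "f = u - avg *v u"
    have L0: "L *v (avg *v u) = 0" by (intro laplacian_const) (simp add: avg_mult)
    have Lf: "L *v f = g" by (simp add: f_def matrix_vector_mult_diff_distrib L0 u)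
    have "(avg *v u) \<bullet> g = 0" using laplacian_sym[of "avg *v u" u] L0 u by simp
    then have fg: "f \<bullet> g = u \<bullet> g" by (simp add: f_def inner_diff_left)
    have "(\<Sum>x\<in>UNIV. f $ x) = 0" by (simp add: f_def sum_subtractf avg_mult)
    moreover have "f \<noteq> 0" using fg False by auto
    ultimately have f: "f \<in> mean_zero - {0}" by (simp add: mean_zero_def)
    have "ereal (u \<bullet> g) = ereal ((f \<bullet> g)\<^sup>2 / H1_norm_sq E w f)"
      using False by (simp add: H1_norm_sq_eq Lf fg power2_eq_square)
    also have "\<dots> \<le> Hneg1_norm_sq E w g"
      unfolding Hneg1_norm_sq_def using f by (rule SUP_upper)
    finally show ?thesis .
  qed
qed

end

subsection \<open>Spanning forests\<close>

lemma equiv_conn: "equiv UNIV ((adj_rel F)\<^sup>*)"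
proof (rule equivI)
  show "sym ((adj_rel F)\<^sup>*)"
    by (intro sym_rtrancl symI) (simp add: adj_rel_def insert_commute)
qed (auto intro: refl_rtrancl trans_rtrancl)

definition conn :: "'v set set \<Rightarrow> 'v \<Rightarrow> 'v \<Rightarrow> bool" where
  "conn F x y \<longleftrightarrow> (x, y) \<in> (adj_rel F)\<^sup>*"

lemma conn_refl [simp]: "conn F x x"
  by (simp add: conn_def)

lemma conn_sym: "conn F x y \<Longrightarrow> conn F y x"
  using equiv_conn[of F] unfolding conn_def equiv_def sym_def by blast

lemma conn_trans: "conn F x y \<Longrightarrow> conn F y z \<Longrightarrow> conn F x z"
  unfolding conn_def by (rule rtrancl_trans)

lemma conn_edge: "{x, y} \<in> F \<Longrightarrow> conn F x y"
  unfolding conn_def by (auto simp: adj_rel_def)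

lemma conn_mono: "F \<subseteq> F' \<Longrightarrow> conn F x y \<Longrightarrow> conn F' x y"
  unfolding conn_def by (rule rtrancl_mono[THEN subsetD]) (auto simp: adj_rel_def)

text \<open>A walk needs the new edge at most once, since crossing it again leads back to an
  endpoint already visited.\<close>

lemma conn_insert:
  assumes "conn (insert {x, y} F) a b"
  shows "conn F a b \<or> conn F a x \<and> conn F y b \<or> conn F a y \<and> conn F x b"
  using assms unfolding conn_def[of "insert {x, y} F"]
proof (induction rule: rtrancl_induct)
  case base
  then show ?case by simp
next
  case (step b c)
  from step(2) have "conn F b c \<or> b = x \<and> c = y \<or> b = y \<and> c = x"
    by (auto simp: adj_rel_def doubleton_eq_iff intro: conn_edge)
  then show ?case using step(3) conn_trans conn_sym conn_refl by metis
qed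

text \<open>Acyclicity in terms of edge deletion, which suits the exchange of edges between trees
  and forests better than vertex lists.\<close>

definition all_bridges :: "'v set set \<Rightarrow> bool" where
  "all_bridges F \<longleftrightarrow> (\<forall>x y. {x, y} \<in> F \<longrightarrow> \<not> conn (F - {{x, y}}) x y)"

lemma conn_simple_path:
  assumes "conn F x y"
  shows "\<exists>xs. xs \<noteq> [] \<and> distinct xs \<and> hd xs = x \<and> last xs = y
    \<and> (\<forall>i. Suc i < length xs \<longrightarrow> {xs ! i, xs ! Suc i} \<in> F)"
  using assms unfolding conn_def
proof (induction rule: rtrancl_induct)
  case base
  show ?case by (rule exI[of _ "[x]"]) simp
next
  case (step y z)
  then obtain xs where xs: "xs \<noteq> []" "distinct xs" "hd xs = x" "last xs = y"
      "\<And>i. Suc i < length xs \<Longrightarrow> {xs ! i, xs ! Suc i} \<in> F"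
    by blast
  show ?case
  proof (cases "z \<in> set xs")
    case True
    then obtain k where k: "k < length xs" "xs ! k = z" by (auto simp: in_set_conv_nth)
    \<comment> \<open>The new step returns to a vertex of the path, so the path is cut there to keep
      its vertices distinct.\<close>
    let ?ys = "take (Suc k) xs"
    have "last ?ys = z" using k by (simp add: take_Suc_conv_app_nth)
    moreover have "hd ?ys = x" using xs by (simp add: hd_take)
    ultimately show ?thesis
      using xs k by (intro exI[of _ ?ys]) auto
  next
    case False
    have "{(xs @ [z]) ! i, (xs @ [z]) ! Suc i} \<in> F" if "Suc i < length (xs @ [z])" for i
    proof (cases "Suc i < length xs")
      case True
      then show ?thesis using xs(5)[of i] by (simp add: nth_append)
    next
      case False
      then have "i = length xs - 1" "Suc i = length xs" using that xs(1) by auto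
      then show ?thesis using step(2) xs(1,4)
        by (simp add: nth_append last_conv_nth adj_rel_def)
    qed
    then show ?thesis using xs False by (intro exI[of _ "xs @ [z]"]) auto
  qed
qed

text \<open>A simple path joining the ends of a deleted edge closes up to a cycle; conversely, a
  cycle without its closing edge still joins the ends of that edge.\<close>

lemma acyclic_iff_all_bridges:
  assumes nl: "\<And>x. {x, x} \<notin> F"
  shows "edges_acyclic F \<longleftrightarrow> all_bridges F"
proof
  assume ac: "edges_acyclic F"
  show "all_bridges F"
    unfolding all_bridges_def
  proof (intro allI impI notI)
    fix x y assume e: "{x, y} \<in> F" and c: "conn (F - {{x, y}}) x y"
    from conn_simple_path[OF c] obtain xs where xs: "xs \<noteq> []" "distinct xs" "hd xs = x" "last xs = y"
      "\<And>i. Suc i < length xs \<Longrightarrow> {xs ! i, xs ! Suc i} \<in> F - {{x, y}}"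
      by blast
    have ne: "x \<noteq> y" using e nl by auto
    have x: "xs ! 0 = x" and y: "xs ! (length xs - 1) = y"
      using xs by (auto simp: hd_conv_nth last_conv_nth)
    have "length xs \<noteq> 1" using ne x y by auto
    \<comment> \<open>A path on two vertices would use the deleted edge itself.\<close>
    moreover have "length xs \<noteq> 2" using xs(5)[of 0] x y by auto
    moreover have "length xs \<noteq> 0" using xs(1) by simp
    ultimately have 3: "3 \<le> length xs" by linarith
    have "{xs ! i, xs ! (Suc i mod length xs)} \<in> F" if "i < length xs" for i
    proof (cases "Suc i < length xs")
      case True
      then show ?thesis using xs(5)[of i] by simp
    next
      case False
      then have "Suc i = length xs" "i = length xs - 1" using that by auto
      then show ?thesis using x y e by (simp add: insert_commute)
    qed
    then have "is_cycle F xs" using 3 xs(2) by (simp add: is_cycle_def)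
    then show False using ac by (simp add: edges_acyclic_def)
  qed
next
  assume br: "all_bridges F"
  show "edges_acyclic F"
    unfolding edges_acyclic_def
  proof
    assume "\<exists>xs. is_cycle F xs"
    then obtain xs where xs: "3 \<le> length xs" "distinct xs"
      "\<And>i. i < length xs \<Longrightarrow> {xs ! i, xs ! (Suc i mod length xs)} \<in> F"
      unfolding is_cycle_def by blast
    let ?n = "length xs - 1"
    let ?e = "{xs ! ?n, xs ! 0}"
    have e: "?e \<in> F" using xs(3)[of ?n] xs(1) by (cases xs) auto
    have path: "conn (F - {?e}) (xs ! 0) (xs ! i)" if "i \<le> ?n" for i
      using that
    proof (induction i)
      case 0
      then show ?case by simp
    next
      case (Suc i)
      then have i: "Suc i < length xs" using xs(1) by linarith
      have "{xs ! i, xs ! Suc i} \<in> F" using xs(3)[of i] i by simp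
      \<comment> \<open>By distinctness, equality would force \<open>i = 0\<close> and
        \<open>?n = 1\<close>, against length at least 3.\<close>
      moreover have "{xs ! i, xs ! Suc i} \<noteq> ?e"
      proof
        have inj: "xs ! a = xs ! b \<longleftrightarrow> a = b" if "a < length xs" "b < length xs" for a b
          using nth_eq_iff_index_eq[OF xs(2)] that by simp
        assume "{xs ! i, xs ! Suc i} = ?e"
        moreover have b: "i < length xs" "0 < length xs" "?n < length xs" using i by linarith+
        ultimately have "i = ?n \<and> Suc i = 0 \<or> i = 0 \<and> Suc i = ?n"
          unfolding doubleton_eq_iff inj[OF b(1,3)] inj[OF i b(2)] inj[OF b(1,2)] inj[OF i b(3)]
          by blast
        then show False using xs(1) by linarith
      qed
      ultimately have "conn (F - {?e}) (xs ! i) (xs ! Suc i)" by (intro conn_edge) blast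
      with Suc.IH[OF Suc_leD[OF Suc.prems]] show ?case by (rule conn_trans)
    qed
    have "conn (F - {?e}) (xs ! ?n) (xs ! 0)"
      by (rule conn_sym) (rule path[OF order_refl])
    then show False using br e unfolding all_bridges_def by blast
  qed
qed

lemma all_bridges_mono: "all_bridges F' \<Longrightarrow> F \<subseteq> F' \<Longrightarrow> all_bridges F"
  unfolding all_bridges_def by (meson Diff_mono conn_mono order_refl subsetD)

text \<open>If deleting an old edge \<open>{a, b}\<close> left its ends connected, the detour would
  cross \<open>{x, y}\<close>; its remaining pieces together with \<open>{a, b}\<close> would then
  join \<open>x\<close> to \<open>y\<close> inside \<open>F\<close>.\<close>

lemma all_bridges_insert:
  assumes br: "all_bridges F" and nc: "\<not> conn F x y"
  shows "all_bridges (insert {x, y} F)"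
  unfolding all_bridges_def
proof (intro allI impI notI)
  fix a b assume e: "{a, b} \<in> insert {x, y} F" and c: "conn (insert {x, y} F - {{a, b}}) a b"
  show False
  proof (cases "{a, b} = {x, y}")
    case True
    then have "conn F a b" by (intro conn_mono[OF _ c]) auto
    then show False using True nc conn_sym by (metis doubleton_eq_iff)
  next
    case False
    let ?F = "F - {{a, b}}"
    have ab: "{a, b} \<in> F" using e False by simp
    have "insert {x, y} F - {{a, b}} = insert {x, y} ?F" using False by auto
    with c have "conn ?F a b \<or> conn ?F a x \<and> conn ?F y b \<or> conn ?F a y \<and> conn ?F x b"
      by (metis conn_insert)
    moreover have "\<not> conn ?F a b" using br ab by (simp add: all_bridges_def)
    moreover have "conn F u v" if "conn ?F u v" for u v by (rule conn_mono[OF _ that]) auto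
    ultimately show False using nc conn_edge[OF ab] conn_sym conn_trans by metis
  qed
qed

section \<open>Components of forests and branches of trees\<close>

definition component :: "'v set set \<Rightarrow> 'v \<Rightarrow> 'v set" where
  "component F x = {y. conn F x y}"

lemma edge_components_eq: "edge_components F = range (component F)"
  by (auto simp: edge_components_def quotient_def component_def conn_def Image_def)

lemma component_eq_iff: "component F x = component F y \<longleftrightarrow> conn F x y"
  unfolding component_def using conn_sym conn_trans conn_refl by (metis (mono_tags, lifting) Collect_cong mem_Collect_eq)

lemma component_disjoint: "\<not> conn F x y \<Longrightarrow> component F x \<inter> component F y = {}"
  unfolding component_def using conn_sym conn_trans by fast

lemma edge_components_pair:
  assumes "\<And>z. conn F x z \<or> conn F y z"
  shows "edge_components F = {component F x, component F y}"
proof -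
  have "component F z \<in> {component F x, component F y}" for z using assms[of z] by (metis component_eq_iff insertCI)
  then show ?thesis unfolding edge_components_eq by blast
qed

text \<open>Separated \<open>x\<close> and \<open>y\<close> already account for two components, so
  the count is 2 exactly when no vertex lies outside both.\<close>

lemma card_edge_components_2:
  assumes nc: "\<not> conn F x y"
  shows "card (edge_components F) = 2 \<longleftrightarrow> (\<forall>z. conn F x z \<or> conn F y z)"
proof -
  have ne: "component F x \<noteq> component F y" using nc by (simp add: component_eq_iff)
  show ?thesis
  proof
    assume "card (edge_components F) = 2"
    then have fin: "finite (edge_components F)" by (intro card_ge_0_finite) simp
    have sub: "{component F x, component F y} \<subseteq> edge_components F" by (auto simp: edge_components_eq)
    have "{component F x, component F y} = edge_components F"
      by (rule card_subset_eq[OF fin sub]) (use \<open>card (edge_components F) = 2\<close> ne in simp)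
    then have "component F z \<in> {component F x, component F y}" for z by (auto simp: edge_components_eq)
    then show "\<forall>z. conn F x z \<or> conn F y z" by (metis component_eq_iff insertE singletonD)
  next
    assume "\<forall>z. conn F x z \<or> conn F y z"
    then have "edge_components F = {component F x, component F y}"
      by (intro edge_components_pair) blast
    then show "card (edge_components F) = 2" using ne by simp
  qed
qed

lemma edge_components_2:
  assumes 2: "card (edge_components F) = 2" and T: "T \<in> edge_components F"
  shows "edge_components F = {T, - T}"
proof -
  obtain x where x: "T = component F x" using T by (auto simp: edge_components_eq)
  have "edge_components F \<noteq> {T}" using 2 by auto
  then obtain y where y: "component F y \<noteq> T" using T by (auto simp: edge_components_eq)
  then have nc: "\<not> conn F x y" using component_eq_iff x by metis
  have all: "conn F x z \<or> conn F y z" for z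
    using card_edge_components_2[OF nc] 2 by blast
  then have "component F y = - T"
    using component_disjoint[OF nc] x by (auto simp: component_def)
  moreover have "edge_components F = {component F x, component F y}"
    by (rule edge_components_pair) (rule all)
  ultimately show "edge_components F = {T, - T}" using x by simp
qed

text \<open>Describes the branches of a tree at \<open>x\<close>. For existence, follow a walk from
  \<open>x\<close> to \<open>z\<close> and keep the neighbour through which it last left
  \<open>x\<close>.\<close>

lemma edge_removal_components:
  assumes br: "all_bridges F" and c: "\<And>a b. conn F a b" and zx: "z \<noteq> x"
  shows "\<exists>!y. {x, y} \<in> F \<and> conn (F - {{x, y}}) y z"
proof (rule ex_ex1I)
  have "(x, z) \<in> (adj_rel F)\<^sup>*" using c by (simp add: conn_def)
  then have "z = x \<or> (\<exists>y. {x, y} \<in> F \<and> conn (F - {{x, y}}) y z)"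
  proof (induction rule: rtrancl_induct)
    case base
    then show ?case by simp
  next
    case (step z z')
    have e: "{z, z'} \<in> F" using step(2) by (simp add: adj_rel_def)
    show ?case
    proof (cases "z' = x \<or> z = x")
      case True
      then show ?thesis using e by auto
    next
      case False
      then obtain y where y: "{x, y} \<in> F" "conn (F - {{x, y}}) y z" using step(3) by blast
      have "{z, z'} \<noteq> {x, y}" using False by (auto simp: doubleton_eq_iff)
      then have "conn (F - {{x, y}}) z z'" using e by (intro conn_edge) auto
      then show ?thesis using y conn_trans by metis
    qed
  qed
  then show "\<exists>y. {x, y} \<in> F \<and> conn (F - {{x, y}}) y z" using zx by simp
next
  fix y1 y2
  assume "{x, y1} \<in> F \<and> conn (F - {{x, y1}}) y1 z" and "{x, y2} \<in> F \<and> conn (F - {{x, y2}}) y2 z"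
  then have 1: "{x, y1} \<in> F" "conn (F - {{x, y1}}) y1 z"
    and 2: "{x, y2} \<in> F" "conn (F - {{x, y2}}) y2 z" by auto
  show "y1 = y2"
  proof (rule ccontr)
    assume "y1 \<noteq> y2"
    then have ne: "{x, y1} \<noteq> {x, y2}" by (auto simp: doubleton_eq_iff)
    let ?F1 = "F - {{x, y1}}" and ?F2 = "F - {{x, y2}}"
    let ?H = "F - {{x, y1}} - {{x, y2}}"
    have sep1: "\<not> conn ?F1 x y1" and sep2: "\<not> conn ?F2 x y2"
      using br 1 2 by (auto simp: all_bridges_def)
    have xy2: "conn ?F1 x y2" using 2(1) ne by (intro conn_edge) auto
    have y2z: "\<not> conn ?F1 y2 z"
      using conn_trans[OF conn_trans[OF xy2] conn_sym[OF 1(2)]] sep1 by blast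
    have H1: "conn ?H a b \<Longrightarrow> conn ?F1 a b" and H2: "conn ?H a b \<Longrightarrow> conn ?F2 a b" for a b
      by (erule conn_mono[rotated], blast)+
    \<comment> \<open>The connection from \<open>y2\<close> to \<open>z\<close> is split at
      \<open>{x, y1}\<close>; each of the three cases contradicts that \<open>{x, y1}\<close> or
      \<open>{x, y2}\<close> is a bridge.\<close>
    have "?F2 = insert {x, y1} ?H" using 1(1) ne by auto
    then have "conn ?H y2 z \<or> conn ?H y2 x \<and> conn ?H y1 z \<or> conn ?H y2 y1 \<and> conn ?H x z"
      using 2(2) by (metis conn_insert)
    then show False
      using H1[of y2 z] y2z H2[THEN conn_sym, of y2 x] sep2 conn_trans[OF xy2 H1, of y1] sep1 by blast
  qed
qed

text \<open>The summands are the values of the tree flow with source \<open>g\<close> on the edges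
  leaving \<open>x\<close>. As the total mass is 0, each is minus the mass of the branch beyond that
  edge, and the branches partition all vertices other than \<open>x\<close>.\<close>

lemma sum_edge_removal_components:
  fixes g :: "'v::finite \<Rightarrow> real"
  assumes "all_bridges F" and "\<And>a b. conn F a b" and g: "sum g UNIV = 0"
  shows "(\<Sum>y | {x, y} \<in> F. sum g (component (F - {{x, y}}) x)) = g x"
proof -
  have compl: "sum g (component (F - {{x, y}}) x) = - sum g (component (F - {{x, y}}) y)" if e: "{x, y} \<in> F" for y
  proof -
    let ?F = "F - {{x, y}}"
    have nc: "\<not> conn ?F x y" using assms(1) e by (simp add: all_bridges_def)
    have "conn ?F x z \<or> conn ?F y z" for z
    proof -
      have "conn (insert {x, y} ?F) x z" using assms(2) e by (simp add: insert_absorb)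
      from conn_insert[OF this] show ?thesis by auto
    qed
    then have "component ?F x \<union> component ?F y = UNIV" by (auto simp: component_def)
    then show ?thesis
      using g sum.union_disjoint[of "component ?F x" "component ?F y" g] component_disjoint[OF nc] by auto
  qed
  have notin: "x \<notin> component (F - {{x, y}}) y" if "{x, y} \<in> F" for y
    using assms(1) that conn_sym unfolding all_bridges_def component_def by fast
  have "(\<Sum>y | {x, y} \<in> F. sum g (component (F - {{x, y}}) x))
      = - (\<Sum>y | {x, y} \<in> F. sum g (component (F - {{x, y}}) y))"
    by (simp add: compl sum_negf)
  also have "(\<Sum>y | {x, y} \<in> F. sum g (component (F - {{x, y}}) y))
      = sum g (\<Union>y\<in>{y. {x, y} \<in> F}. component (F - {{x, y}}) y)"
  proof (rule sum.UNION_disjoint[symmetric], simp, simp, intro ballI impI)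
    fix y1 y2 assume y: "y1 \<in> {y. {x, y} \<in> F}" "y2 \<in> {y. {x, y} \<in> F}" "y1 \<noteq> y2"
    have "z = x" if "z \<in> component (F - {{x, y1}}) y1 \<inter> component (F - {{x, y2}}) y2" for z
      using edge_removal_components[OF assms(1,2), where z=z and x=x] that y by (auto simp: component_def)
    moreover have "x \<notin> component (F - {{x, y1}}) y1"
      using notin y(1) by simp
    ultimately show "component (F - {{x, y1}}) y1 \<inter> component (F - {{x, y2}}) y2 = {}" by blast
  qed
  also have "(\<Union>y\<in>{y. {x, y} \<in> F}. component (F - {{x, y}}) y) = UNIV - {x}"
  proof -
    have "\<exists>y. {x, y} \<in> F \<and> z \<in> component (F - {{x, y}}) y" if "z \<noteq> x" for z
      using edge_removal_components[OF assms(1,2) that] by (auto simp: component_def)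
    then show ?thesis using notin by blast
  qed
  also have "sum g (UNIV - {x}) = - g x"
    using g by (simp add: sum_diff1)
  finally show ?thesis by simp
qed

text \<open>Takes a connected subset with the fewest edges: an edge that is not a bridge could be
  dropped.\<close>

lemma spanning_tree_exists:
  fixes E :: "'v::finite set set"
  assumes "edges_connected E"
  shows "\<exists>F\<subseteq>E. all_bridges F \<and> edges_connected F"
proof -
  let ?P = "\<lambda>F. F \<subseteq> E \<and> edges_connected F"
  obtain F where F: "?P F" and min: "\<And>F'. ?P F' \<Longrightarrow> card F \<le> card F'"
    using exists_least_iff[of "\<lambda>n. \<exists>F. ?P F \<and> card F = n"] assms by (metis order_refl not_le)
  have "all_bridges F"
    unfolding all_bridges_def
  proof (intro allI impI notI)
    fix x y assume e: "{x, y} \<in> F" and c: "conn (F - {{x, y}}) x y"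
    have "conn (F - {{x, y}}) a b" for a b
    proof -
      have "conn F a b" using F by (simp add: edges_connected_def conn_def)
      then have "conn (insert {x, y} (F - {{x, y}})) a b" using e by (simp add: insert_absorb)
      from conn_insert[OF this] show ?thesis
        using conn_trans[OF conn_trans[OF _ c], of a b]
          conn_trans[OF conn_trans[OF _ conn_sym[OF c]], of a b] by blast
    qed
    then have "card F \<le> card (F - {{x, y}})"
      using F by (intro min) (auto simp: edges_connected_def conn_def)
    moreover have "0 < card F" using e by (auto simp: card_gt_0_iff)
    ultimately show False using e by (simp add: card_Diff_singleton)
  qed
  then show ?thesis using F by blast
qed

section \<open>Edge exchange between spanning trees and 2-forests\<close>

context connected_graph
begin

lemma spanning_trees_eq: "spanning_trees E = {F. F \<subseteq> E \<and> all_bridges F \<and> (\<forall>a b. conn F a b)}"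
  using acyclic_iff_all_bridges no_loop unfolding spanning_trees_def edges_connected_def conn_def
  by (metis (no_types, lifting) subsetD)

lemma spanning_2_forests_eq:
  "spanning_2_forests E = {F. F \<subseteq> E \<and> all_bridges F \<and> card (edge_components F) = 2}"
  using acyclic_iff_all_bridges no_loop unfolding spanning_2_forests_def
  by (metis (no_types, lifting) subsetD)

lemma weight_prod_pos: "F \<subseteq> E \<Longrightarrow> 0 < weight_prod w F"
  unfolding weight_prod_def by (intro prod_pos) (use weight_pos[OF G] in auto)

lemma tree_weight_sum_pos: "0 < tree_weight_sum E w"
proof -
  obtain F where F: "F \<in> spanning_trees E"
    using spanning_tree_exists[OF con] by (auto simp: spanning_trees_eq edges_connected_def conn_def)
  show ?thesis
    unfolding tree_weight_sum_def
    by (rule sum_pos2[OF _ F])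
      (use F weight_prod_pos in \<open>auto simp: spanning_trees_def less_imp_le\<close>)
qed

definition forest_potential :: "('v \<Rightarrow> real) \<Rightarrow> real^'v" where
  "forest_potential g = (\<chi> x.
     (\<Sum>F\<in>spanning_2_forests E. weight_prod w F * sum g (component F x)) / (2 * tree_weight_sum E w))"

text \<open>The two components carry opposite masses, which doubles the difference; this 2 cancels
  the one in the denominator of \<open>forest_potential\<close>.\<close>

lemma forest_sum_diff:
  fixes g :: "'v \<Rightarrow> real"
  assumes g: "sum g UNIV = 0" and F: "F \<in> spanning_2_forests E"
  shows "sum g (component F x) - sum g (component F y) = (if conn F x y then 0 else 2 * sum g (component F x))"
proof (cases "conn F x y")
  case True
  then have "component F x = component F y" by (simp add: component_eq_iff)
  then show ?thesis using True by simp
next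
  case False
  have c: "component F x \<in> edge_components F" "component F y \<in> edge_components F"
    by (auto simp: edge_components_eq)
  have "component F y \<noteq> component F x" using False component_eq_iff by metis
  then have "component F y = - component F x"
    using edge_components_2[OF _ c(1)] F c(2) by (auto simp: spanning_2_forests_def)
  moreover have "sum g (component F x) + sum g (- component F x) = 0"
    using g sum.union_disjoint[of "component F x" "- component F x" g] by simp
  ultimately show ?thesis using False by simp
qed

text \<open>Inserting \<open>{x, y}\<close> into a 2-forest that separates \<open>x\<close> from
  \<open>y\<close> gives a spanning tree, and deleting it from the tree undoes this. The weight
  gains the factor \<open>w {x, y}\<close>, and the component of \<open>x\<close> is read off after
  the deletion.\<close>

lemma forest_tree_exchange:
  "(\<Sum>y | {x, y} \<in> E. \<Sum>F | F \<in> spanning_2_forests E \<and> \<not> conn F x y.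
      w {x, y} * weight_prod w F * h (component F x)) =
   (\<Sum>T\<in>spanning_trees E. \<Sum>y | {x, y} \<in> T. weight_prod w T * h (component (T - {{x, y}}) x))"
proof -
  let ?S = "SIGMA y:{y. {x, y} \<in> E}. {F \<in> spanning_2_forests E. \<not> conn F x y}"
  let ?R = "SIGMA T:spanning_trees E. {y. {x, y} \<in> T}"
  have "(\<Sum>(y, F)\<in>?S. w {x, y} * weight_prod w F * h (component F x))
      = (\<Sum>(T, y)\<in>?R. weight_prod w T * h (component (T - {{x, y}}) x))"
  proof (rule sum.reindex_bij_witness[where j="\<lambda>(y, F). (insert {x, y} F, y)"
        and i="\<lambda>(T, y). (y, T - {{x, y}})"]; clarsimp)
    fix y F assume y: "{x, y} \<in> E" and F: "F \<in> spanning_2_forests E" and nc: "\<not> conn F x y"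
    show notin: "F - {{x, y}} = F" using nc conn_edge[of x y F] by auto
    have F': "F \<subseteq> E" "all_bridges F" and card: "card (edge_components F) = 2"
      using F by (auto simp: spanning_2_forests_eq)
    have sp: "conn F x z \<or> conn F y z" for z
      using card_edge_components_2[OF nc] card by blast
    let ?T = "insert {x, y} F"
    have mono: "conn F a b \<Longrightarrow> conn ?T a b" for a b
      by (rule conn_mono[OF subset_insertI])
    have xz: "conn ?T x z" for z
      using sp[of z] mono conn_trans[OF conn_edge[OF insertI1] mono] by blast
    have "conn ?T a b" for a b by (rule conn_trans[OF conn_sym[OF xz] xz])
    then show "?T \<in> spanning_trees E"
      using y F' all_bridges_insert[OF F'(2) nc] unfolding spanning_trees_eq by blast
    have "weight_prod w ?T = w {x, y} * weight_prod w F"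
      using nc conn_edge[of x y F] by (subst weight_prod_def, subst prod.insert) (auto simp: weight_prod_def)
    then show "weight_prod w ?T * h (component (F - {{x, y}}) x) = w {x, y} * weight_prod w F * h (component F x)"
      using notin by simp
  next
    fix T y assume T: "T \<in> spanning_trees E" and y: "{x, y} \<in> T"
    show "insert {x, y} T = T" using y by auto
    have T': "T \<subseteq> E" "all_bridges T" "\<And>a b. conn T a b" using T by (auto simp: spanning_trees_eq)
    let ?F = "T - {{x, y}}"
    have nc: "\<not> conn ?F x y" using T'(2) y by (simp add: all_bridges_def)
    have "conn ?F x z \<or> conn ?F y z" for z
    proof -
      have "conn (insert {x, y} ?F) x z" using T'(3) y by (simp add: insert_absorb)
      from conn_insert[OF this] show ?thesis by auto
    qed
    then have "?F \<in> spanning_2_forests E"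
      using T'(1) all_bridges_mono[OF T'(2)] card_edge_components_2[OF nc]
      by (auto simp: spanning_2_forests_eq)
    then show "{x, y} \<in> E \<and> ?F \<in> spanning_2_forests E \<and> \<not> conn ?F x y"
      using nc T'(1) y by auto
  qed
  then show ?thesis by (simp add: sum.Sigma)
qed

lemma laplacian_forest_potential:
  assumes g: "sum g UNIV = 0"
  shows "(L *v forest_potential g) $ x = g x"
proof -
  let ?F = "spanning_2_forests E" and ?\<tau> = "tree_weight_sum E w" and ?W = "weight_prod w"
  let ?c = "\<lambda>F x. sum g (component F x)"
  have diff: "forest_potential g $ x - forest_potential g $ y
      = (\<Sum>F | F \<in> ?F \<and> \<not> conn F x y. ?W F * ?c F x) / ?\<tau>" for y
  proof -
    have "(\<Sum>F\<in>?F. ?W F * ?c F x) - (\<Sum>F\<in>?F. ?W F * ?c F y)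
        = (\<Sum>F\<in>?F. ?W F * (?c F x - ?c F y))"
      by (simp add: sum_subtractf right_diff_distrib)
    also have "\<dots> = (\<Sum>F\<in>?F. if conn F x y then 0 else 2 * (?W F * ?c F x))"
      by (intro sum.cong refl) (simp add: forest_sum_diff[OF g])
    also have "\<dots> = 2 * (\<Sum>F | F \<in> ?F \<and> \<not> conn F x y. ?W F * ?c F x)"
      by (simp add: sum.If_cases sum_distrib_left Int_def conj_commute)
    finally show ?thesis
      by (simp add: forest_potential_def diff_divide_distrib[symmetric])
  qed
  have "(L *v forest_potential g) $ x
      = (\<Sum>y | {x, y} \<in> E. \<Sum>F | F \<in> ?F \<and> \<not> conn F x y. w {x, y} * ?W F * ?c F x) / ?\<tau>"
    by (simp add: laplacian_mult diff sum_distrib_left sum_divide_distrib mult.assoc)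
  \<comment> \<open>For each tree the inner sum is the divergence at \<open>x\<close> of its flow,
    hence \<open>g x\<close>.\<close>
  also have "\<dots> = (\<Sum>T\<in>spanning_trees E. ?W T * g x) / ?\<tau>"
    by (subst forest_tree_exchange[of x "sum g"], intro arg_cong[of _ _ "\<lambda>s. s / ?\<tau>"] sum.cong refl)
      (simp add: sum_distrib_left[symmetric] sum_edge_removal_components[OF _ _ g] spanning_trees_eq)
  also have "\<dots> = g x"
    using tree_weight_sum_pos by (simp add: sum_distrib_right[symmetric] tree_weight_sum_def)
  finally show ?thesis .
qed

text \<open>Paired with \<open>g\<close>, a 2-forest contributes the squared masses of both
  components. These are equal, so the choice of \<open>T F\<close> does not matter and the resulting
  2 cancels.\<close>

lemma forest_formula:
  assumes g: "sum g UNIV = 0"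
    and T: "\<And>F. F \<in> spanning_2_forests E \<Longrightarrow> T F \<in> edge_components F"
  shows "(\<Sum>x\<in>UNIV. forest_potential g $ x * g x)
    = 1 / tree_weight_sum E w * (\<Sum>F\<in>spanning_2_forests E. weight_prod w F * (sum g (T F))\<^sup>2)"
proof -
  let ?F = "spanning_2_forests E" and ?\<tau> = "tree_weight_sum E w" and ?W = "weight_prod w"
  have comp_sum: "(\<Sum>x\<in>UNIV. sum g (component F x) * g x) = 2 * (sum g (T F))\<^sup>2" if F: "F \<in> ?F" for F
  proof -
    have ec: "edge_components F = {T F, - T F}"
      using edge_components_2 T[OF F] F by (auto simp: spanning_2_forests_def)
    have "component F x = (if x \<in> T F then T F else - T F)" for x
    proof -
      have "component F x \<in> {T F, - T F}" using ec by (auto simp: edge_components_eq)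
      moreover have "x \<in> component F x" by (simp add: component_def)
      ultimately show ?thesis by auto
    qed
    then have "(\<Sum>x\<in>UNIV. sum g (component F x) * g x)
        = (\<Sum>x\<in>UNIV. if x \<in> T F then sum g (T F) * g x else sum g (- T F) * g x)"
      by (intro sum.cong) auto
    also have "\<dots> = (sum g (T F))\<^sup>2 + (sum g (- T F))\<^sup>2"
      by (simp add: sum.If_cases sum_distrib_left[symmetric] power2_eq_square Compl_eq)
    also have "sum g (- T F) = - sum g (T F)"
      using g sum.union_disjoint[of "T F" "- T F" g] by simp
    finally show ?thesis by simp
  qed
  have "(\<Sum>x\<in>UNIV. forest_potential g $ x * g x)
      = (\<Sum>F\<in>?F. ?W F * (\<Sum>x\<in>UNIV. sum g (component F x) * g x)) / (2 * ?\<tau>)"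
    by (simp add: forest_potential_def sum_divide_distrib[symmetric] sum_distrib_left sum_distrib_right
        sum.swap[of _ UNIV] mult.assoc)
  also have "\<dots> = 1 / ?\<tau> * (\<Sum>F\<in>?F. ?W F * (sum g (T F))\<^sup>2)"
    by (simp add: comp_sum mult.left_commute[of _ 2] flip: sum_distrib_left)
  finally show ?thesis .
qed

end

subsection \<open>Hitting times\<close>

text \<open>The tail-sum formula, trajectory by trajectory: the term at \<open>n\<close> is 1
  exactly while \<open>y\<close> has not been visited up to time \<open>n\<close>. If it never is,
  both sides are infinite.\<close>

lemma hitting_time_suminf:
  "hitting_time y \<omega> = (\<Sum>n. indicator {\<omega>. \<forall>t\<le>n. \<omega> t \<noteq> y} \<omega>)"
proof (cases "\<exists>t. \<omega> t = y")
  case True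
  define k where "k = (LEAST t. \<omega> t = y)"
  have k: "\<omega> k = y" unfolding k_def using True by (rule LeastI_ex)
  have le: "k \<le> t" if "\<omega> t = y" for t unfolding k_def using that by (rule Least_le)
  have "hitting_time y \<omega> = of_nat k"
    unfolding hitting_time_def by (rule antisym) (auto intro!: INF_lower2[of k] INF_greatest k le)
  moreover have ind: "(\<forall>t\<le>n. \<omega> t \<noteq> y) \<longleftrightarrow> n < k" for n
    using k le by (metis le_trans not_le)
  then have "(\<Sum>n. indicator {\<omega>. \<forall>t\<le>n. \<omega> t \<noteq> y} \<omega>) = (\<Sum>n<k. (1::ennreal))"
    by (subst suminf_finite[of "{..<k}"]) (auto simp: indicator_def)
  ultimately show ?thesis by simp
next
  case False
  have "(\<Sum>n. indicator {\<omega>. \<forall>t\<le>n. \<omega> t \<noteq> y} \<omega>) = (\<Sum>n. (1::ennreal))"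
    using False by (simp add: indicator_def)
  also have "\<dots> = (SUP n. of_nat n)"
    by (simp add: suminf_eq_SUP)
  also have "\<dots> = top" by (rule ennreal_SUP_of_nat_eq_top)
  finally show ?thesis using False by (simp add: hitting_time_def)
qed

context connected_graph
begin

section \<open>Probabilities of avoiding a vertex\<close>

abbreviation "P x y \<equiv> transition_matrix E w $ x $ y"

lemma transition_nonneg: "0 \<le> P x y"
  by (metis pmf_nonneg pmf_step_pmf[OF G con])

lemma transition_sum: "(\<Sum>y\<in>UNIV. P x y * f y) = (\<Sum>y | {x, y} \<in> E. w {x, y} * f y) / deg E w x"
  by (simp add: transition_matrix_entry[OF G con] adjacency_matrix_def sum_divide_distrib
      if_distrib[of "\<lambda>a. a * _"] if_distrib[of "\<lambda>a. a / _"] sum.If_cases cong: if_cong)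

lemma transition_sum_1: "(\<Sum>y\<in>UNIV. P x y) = 1"
  using transition_sum[of x "\<lambda>_. 1"] deg_pos[OF G con, of x] by (simp add: deg_def)

text \<open>The probability that the walk from \<open>x\<close> is not at \<open>y\<close> at times
  1 to \<open>n\<close>. Time 0 is not tested, so the value at \<open>x = y\<close> need not
  vanish.\<close>

fun survival :: "'v \<Rightarrow> nat \<Rightarrow> 'v \<Rightarrow> real" where
  "survival y 0 x = 1"
| "survival y (Suc n) x = (\<Sum>z\<in>UNIV - {y}. P x z * survival y n z)"

lemma survival_nonneg: "0 \<le> survival y n x"
  by (induction n arbitrary: x) (auto intro!: sum_nonneg mult_nonneg_nonneg transition_nonneg)

lemma sets_walk_law_event: "{\<omega>. \<forall>t\<in>S. \<omega> t \<in> A t} \<in> sets (walk_law E w x)"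
proof -
  have "{\<omega> \<in> space (\<Pi>\<^sub>M t\<in>UNIV. count_space UNIV). \<forall>t\<in>S. \<omega> t \<in> A t}
      \<in> sets (\<Pi>\<^sub>M t\<in>(UNIV::nat set). count_space (UNIV::'v set))"
    by measurable
  then show ?thesis by (simp add: sets_walk_law space_PiM)
qed

text \<open>Prescribing the first \<open>n\<close> steps lets cylinder probabilities stand in for
  the Markov property: splitting by the position at time \<open>Suc n\<close> lengthens the prefix
  by one and lowers \<open>k\<close> by one.\<close>

lemma emeasure_walk_law_avoid:
  "emeasure (walk_law E w x)
     {\<omega>. (\<forall>t\<le>n. \<omega> t = p t) \<and> (\<forall>t. n < t \<and> t \<le> n + k \<longrightarrow> \<omega> t \<noteq> y)} =
   ennreal ((if p 0 = x then 1 else 0) * (\<Prod>t<n. P (p t) (p (Suc t))) * survival y k (p n))"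
proof (induction k arbitrary: n p)
  case 0
  have "{\<omega>. (\<forall>t\<le>n. \<omega> t = p t) \<and> (\<forall>t. n < t \<and> t \<le> n + 0 \<longrightarrow> \<omega> t \<noteq> y)} = {\<omega>. \<forall>t\<le>n. \<omega> t = p t}"
    by auto
  then show ?case using emeasure_walk_law_cylinder[OF G con, of x n p] by simp
next
  case (Suc k)
  let ?A = "\<lambda>n p k. {\<omega>. (\<forall>t\<le>n. \<omega> t = p t) \<and> (\<forall>t. n < t \<and> t \<le> n + k \<longrightarrow> \<omega> t \<noteq> y)}"
  let ?c = "(if p 0 = x then 1 else 0) * (\<Prod>t<n. P (p t) (p (Suc t)))"
  have meas: "?A n p k \<in> sets (walk_law E w x)" for n p k
  proof -
    have "?A n p k = {\<omega>. \<forall>t\<in>{..n + k}. \<omega> t \<in> (if t \<le> n then {p t} else - {y})}"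
    proof (intro set_eqI iffI)
      fix \<omega> assume *: "\<omega> \<in> {\<omega>. \<forall>t\<in>{..n + k}. \<omega> t \<in> (if t \<le> n then {p t} else - {y})}"
      have mem: "\<omega> t \<in> (if t \<le> n then {p t} else - {y})" if "t \<le> n + k" for t
        using * that by blast
      have "\<omega> t = p t" if "t \<le> n" for t
        using mem[of t] that by simp
      moreover have "\<omega> t \<noteq> y" if "n < t" "t \<le> n + k" for t
        using mem[of t] that by simp
      ultimately show "\<omega> \<in> ?A n p k" by blast
    qed auto
    then show ?thesis using sets_walk_law_event[of "{..n + k}" "\<lambda>t. if t \<le> n then {p t} else - {y}"] by simp
  qed
  have split: "?A n p (Suc k) = (\<Union>z\<in>UNIV - {y}. ?A (Suc n) (p(Suc n := z)) k)"
  proof (intro set_eqI iffI)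
    fix \<omega> assume \<omega>: "\<omega> \<in> ?A n p (Suc k)"
    then have "\<omega> (Suc n) \<in> UNIV - {y}" by auto
    moreover have "\<omega> \<in> ?A (Suc n) (p(Suc n := \<omega> (Suc n))) k"
      using \<omega> by (auto simp: le_Suc_eq)
    ultimately show "\<omega> \<in> (\<Union>z\<in>UNIV - {y}. ?A (Suc n) (p(Suc n := z)) k)" by blast
  next
    fix \<omega> assume "\<omega> \<in> (\<Union>z\<in>UNIV - {y}. ?A (Suc n) (p(Suc n := z)) k)"
    then obtain z where z: "z \<noteq> y" and 1: "\<And>t. t \<le> Suc n \<Longrightarrow> \<omega> t = (p(Suc n := z)) t"
      and 2: "\<And>t. Suc n < t \<Longrightarrow> t \<le> Suc n + k \<Longrightarrow> \<omega> t \<noteq> y" by auto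
    have "\<omega> t = p t" if "t \<le> n" for t using 1[of t] that by simp
    moreover have "\<omega> t \<noteq> y" if "n < t" "t \<le> n + Suc k" for t
      using 1[of "Suc n"] 2[of t] z that by (cases "t = Suc n") auto
    ultimately show "\<omega> \<in> ?A n p (Suc k)" by auto
  qed
  have disj: "disjoint_family_on (\<lambda>z. ?A (Suc n) (p(Suc n := z)) k) (UNIV - {y})"
    by (auto simp: disjoint_family_on_def)
  have "emeasure (walk_law E w x) (?A n p (Suc k))
      = (\<Sum>z\<in>UNIV - {y}. emeasure (walk_law E w x) (?A (Suc n) (p(Suc n := z)) k))"
    unfolding split
    by (rule sum_emeasure[symmetric], rule image_subsetI, rule meas, rule disj, rule finite)
  also have "\<dots> = (\<Sum>z\<in>UNIV - {y}. ennreal (?c * P (p n) z * survival y k z))"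
  proof (rule sum.cong[OF refl])
    fix z
    have "(\<Prod>t<n. P ((p(Suc n := z)) t) ((p(Suc n := z)) (Suc t))) = (\<Prod>t<n. P (p t) (p (Suc t)))"
      by (intro prod.cong) auto
    then show "emeasure (walk_law E w x) (?A (Suc n) (p(Suc n := z)) k) = ennreal (?c * P (p n) z * survival y k z)"
      unfolding Suc.IH prod.lessThan_Suc by (simp add: mult.assoc)
  qed
  also have "\<dots> = ennreal (\<Sum>z\<in>UNIV - {y}. ?c * P (p n) z * survival y k z)"
    by (intro sum_ennreal mult_nonneg_nonneg prod_nonneg) (auto intro: transition_nonneg survival_nonneg)
  also have "(\<Sum>z\<in>UNIV - {y}. ?c * P (p n) z * survival y k z) = ?c * survival y (Suc k) (p n)"
    by (simp add: sum_distrib_left mult.assoc)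
  finally show ?case .
qed

lemma prob_avoid:
  "emeasure (walk_law E w x) {\<omega>. \<forall>t\<le>n. \<omega> t \<noteq> y} = ennreal (if x = y then 0 else survival y n x)"
proof -
  let ?M = "walk_law E w x" and ?B = "{\<omega>. \<forall>t\<le>n. \<omega> t \<noteq> y}"
  have start: "emeasure ?M {\<omega>. \<omega> 0 = z} = (if z = x then 1 else 0)" for z
    using emeasure_walk_law_cylinder[OF G con, of x 0 "\<lambda>_. z"] by simp
  have Bm: "?B \<in> sets ?M"
    using sets_walk_law_event[of "{..n}" "\<lambda>_. - {y}" x] by (simp add: Ball_def)
  have Sm: "{\<omega>. \<omega> 0 = z} \<in> sets ?M" for z
    using sets_walk_law_event[of "{0}" "\<lambda>_. {z}" x] by simp
  \<comment> \<open>The law lives on all trajectories; those not starting at \<open>x\<close> form a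
    null set, which this splitting isolates.\<close>
  have "?B = (\<Union>z. ?B \<inter> {\<omega>. \<omega> 0 = z})" by auto
  then have "emeasure ?M ?B = (\<Sum>z\<in>UNIV. emeasure ?M (?B \<inter> {\<omega>. \<omega> 0 = z}))"
    using Bm Sm by (subst sum_emeasure) (auto simp: disjoint_family_on_def)
  also have "\<dots> = (\<Sum>z\<in>UNIV. if z = x then emeasure ?M (?B \<inter> {\<omega>. \<omega> 0 = x}) else 0)"
  proof (rule sum.cong[OF refl])
    fix z
    have "emeasure ?M (?B \<inter> {\<omega>. \<omega> 0 = z}) \<le> emeasure ?M {\<omega>. \<omega> 0 = z}"
      using Sm by (intro emeasure_mono) auto
    then show "emeasure ?M (?B \<inter> {\<omega>. \<omega> 0 = z}) = (if z = x then emeasure ?M (?B \<inter> {\<omega>. \<omega> 0 = x}) else 0)"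
      using start[of z] by (cases "z = x") auto
  qed
  also have "\<dots> = emeasure ?M (?B \<inter> {\<omega>. \<omega> 0 = x})" by simp
  also have "\<dots> = ennreal (if x = y then 0 else survival y n x)"
  proof (cases "x = y")
    case True
    then have "?B \<inter> {\<omega>. \<omega> 0 = x} = {}" by auto
    then show ?thesis using True by simp
  next
    case False
    then have "?B \<inter> {\<omega>. \<omega> 0 = x}
        = {\<omega>. (\<forall>t\<le>0. \<omega> t = x) \<and> (\<forall>t. 0 < t \<and> t \<le> 0 + n \<longrightarrow> \<omega> t \<noteq> y)}"
      by (auto simp: less_Suc_eq_0_disj) (metis neq0_conv)
    then show ?thesis
      using False emeasure_walk_law_avoid[of x 0 "\<lambda>_. x" n y] by simp
  qed
  finally show ?thesis .
qed

text \<open>By \<open>prob_avoid\<close>, the probability that the hitting time of \<open>y\<close>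
  exceeds \<open>n\<close>. Unlike for \<open>survival\<close>, time 0 counts.\<close>

definition killed :: "'v \<Rightarrow> nat \<Rightarrow> 'v \<Rightarrow> real" where
  "killed y n x = (if x = y then 0 else survival y n x)"

lemma killed_nonneg: "0 \<le> killed y n x"
  by (simp add: killed_def survival_nonneg)

lemma killed_0: "killed y 0 x = (if x = y then 0 else 1)"
  by (simp add: killed_def)

lemma killed_Suc: "killed y (Suc n) x = (if x = y then 0 else \<Sum>z\<in>UNIV. P x z * killed y n z)"
proof -
  have "(\<Sum>z\<in>UNIV. P x z * killed y n z) = (\<Sum>z\<in>UNIV - {y}. P x z * survival y n z)"
    by (rule sum.mono_neutral_cong_right) (auto simp: killed_def)
  then show ?thesis by (simp add: killed_def)
qed

lemma expected_hitting_time_suminf: "expected_hitting_time E w x y = (\<Sum>n. ennreal (killed y n x))"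
proof -
  have "{\<omega>. \<forall>t\<le>n. \<omega> t \<noteq> y} \<in> sets (walk_law E w x)" for n
    using sets_walk_law_event[of "{..n}" "\<lambda>_. - {y}" x] by (simp add: Ball_def)
  then show ?thesis
    unfolding expected_hitting_time_def hitting_time_suminf
    by (subst nn_integral_suminf) (auto simp: prob_avoid killed_def)
qed

text \<open>
  Bounds the partial sums of the tail probabilities from above, which gives finiteness of the
  expected hitting times.
\<close>

lemma hitting_potential_exists:
  "\<exists>h. h y = 0 \<and> (\<forall>x. 0 \<le> h x) \<and> (\<forall>x. x \<noteq> y \<longrightarrow> h x = 1 + (\<Sum>z\<in>UNIV. P x z * h z))"
proof -
  \<comment> \<open>Subtracting the volume at \<open>y\<close> makes the degree vector sum to 0,
    hence solvable. Away from \<open>y\<close>, dividing by the degree gives the first step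
    equation.\<close>
  have "(\<Sum>x\<in>UNIV. (\<chi> x. deg E w x - (if x = y then vol E w else 0)) $ x) = 0"
    by (simp add: sum_subtractf vol_def)
  from laplacian_solvable[OF this] obtain f
    where f: "L *v f = (\<chi> x. deg E w x - (if x = y then vol E w else 0))" by blast
  define h where "h x = f $ x - f $ y" for x
  have eq: "h x = 1 + (\<Sum>z\<in>UNIV. P x z * h z)" if "x \<noteq> y" for x
  proof -
    have d: "0 < deg E w x" by (rule deg_pos[OF G con])
    have "(L *v f) $ x = deg E w x" using f that by simp
    moreover have "(L *v f) $ x = (\<Sum>z | {x, z} \<in> E. w {x, z} * (h x - h z))"
      by (simp add: laplacian_mult h_def)
    moreover have "\<dots> = deg E w x * h x - (\<Sum>z | {x, z} \<in> E. w {x, z} * h z)"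
      by (simp add: right_diff_distrib sum_subtractf sum_distrib_right deg_def)
    ultimately show ?thesis using d unfolding transition_sum by (simp add: field_simps)
  qed
  have "0 \<le> h x" for x
  proof -
    have "finite (range h)" by simp
    then obtain m where m: "\<And>z. h m \<le> h z"
      using Min_in[of "range h"] Min_le[of "range h"] by (metis UNIV_not_empty image_iff image_is_empty rangeI)
    \<comment> \<open>Minimum principle: at a minimizer other than \<open>y\<close>, the first step
      equation would give \<open>h m \<ge> 1 + h m\<close>.\<close>
    have "m = y"
    proof (rule ccontr)
      assume "m \<noteq> y"
      then have "h m = 1 + (\<Sum>z\<in>UNIV. P m z * h z)" by (rule eq)
      moreover have "(\<Sum>z\<in>UNIV. P m z * h m) \<le> (\<Sum>z\<in>UNIV. P m z * h z)"
        by (intro sum_mono mult_left_mono m transition_nonneg)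
      moreover have "(\<Sum>z\<in>UNIV. P m z * h m) = h m"
        by (simp add: sum_distrib_right[symmetric] transition_sum_1)
      ultimately show False by simp
    qed
    then show ?thesis using m[of x] by (simp add: h_def)
  qed
  then show ?thesis using eq by (intro exI[of _ h]) (simp add: h_def)
qed

text \<open>First step analysis for the expected hitting time capped at
  \<open>Suc N\<close>.\<close>

lemma killed_partial_sum:
  "(\<Sum>n<Suc N. killed y n x) = (if x = y then 0 else 1 + (\<Sum>z\<in>UNIV. P x z * (\<Sum>n<N. killed y n z)))"
  unfolding sum.lessThan_Suc_shift
  by (simp add: killed_0 killed_Suc sum_distrib_left sum.swap[of _ UNIV])

text \<open>The potential \<open>h\<close> solves the recursion of the capped expectations and is
  nonnegative, so it dominates all of them by induction.\<close>

lemma summable_killed: "summable (\<lambda>n. killed y n x)"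
proof -
  obtain h where h: "h y = 0" "\<And>x. 0 \<le> h x" "\<And>x. x \<noteq> y \<Longrightarrow> h x = 1 + (\<Sum>z\<in>UNIV. P x z * h z)"
    using hitting_potential_exists by blast
  have "(\<Sum>n<N. killed y n x) \<le> h x" for N x
  proof (induction N arbitrary: x)
    case 0
    then show ?case using h(2) by simp
  next
    case (Suc N)
    have "(\<Sum>z\<in>UNIV. P x z * (\<Sum>n<N. killed y n z)) \<le> (\<Sum>z\<in>UNIV. P x z * h z)"
      by (intro sum_mono mult_left_mono Suc.IH transition_nonneg)
    then show ?case using h(1) h(3)[of x] by (simp add: killed_partial_sum del: sum.lessThan_Suc)
  qed
  then show ?thesis
    by (intro summableI_nonneg_bounded killed_nonneg)
qed

section \<open>Expected hitting times and the Laplacian\<close>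

lemma expected_hitting_time_eq: "expected_hitting_time E w x y = ennreal (\<Sum>n. killed y n x)"
  unfolding expected_hitting_time_suminf
  by (intro suminf_ennreal2 killed_nonneg summable_killed)

lemma expected_hitting_time_finite: "expected_hitting_time E w x y < \<infinity>"
  by (simp add: expected_hitting_time_eq)

abbreviation "H x y \<equiv> enn2real (expected_hitting_time E w x y)"

lemma H_eq: "H x y = (\<Sum>n. killed y n x)"
  unfolding expected_hitting_time_eq by (simp add: suminf_nonneg summable_killed killed_nonneg)

lemma H_step: "H x y = (if x = y then 0 else 1 + (\<Sum>z\<in>UNIV. P x z * H z y))"
proof (cases "x = y")
  case True
  then show ?thesis by (simp add: H_eq killed_def)
next
  case False
  have "H x y = killed y 0 x + (\<Sum>n. killed y (Suc n) x)"
    unfolding H_eq using suminf_split_head[OF summable_killed, of y x] by simp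
  also have "(\<Sum>n. killed y (Suc n) x) = (\<Sum>n. \<Sum>z\<in>UNIV. P x z * killed y n z)"
    using False by (simp add: killed_Suc)
  also have "\<dots> = (\<Sum>z\<in>UNIV. P x z * H z y)"
    by (simp add: suminf_sum suminf_mult summable_mult summable_killed H_eq)
  finally show ?thesis using False by (simp add: killed_0)
qed

text \<open>Away from \<open>y\<close> this is the first step equation times the degree. The value
  at \<open>y\<close> is then forced, because the entries of \<open>L *v f\<close> always sum to
  0.\<close>

lemma laplacian_H: "(L *v (\<chi> x. H x y)) $ x = deg E w x - (if x = y then vol E w else 0)"
proof -
  let ?h = "\<chi> x. H x y"
  have other: "(L *v ?h) $ x = deg E w x" if "x \<noteq> y" for x
  proof -
    have d: "0 < deg E w x" by (rule deg_pos[OF G con])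
    have "(L *v ?h) $ x = deg E w x * H x y - (\<Sum>z | {x, z} \<in> E. w {x, z} * H z y)"
      by (simp add: laplacian_mult right_diff_distrib sum_subtractf sum_distrib_right deg_def)
    moreover have "H x y = 1 + (\<Sum>z | {x, z} \<in> E. w {x, z} * H z y) / deg E w x"
      using H_step[of x y] that by (simp add: transition_sum)
    ultimately show ?thesis using d by (simp add: field_simps)
  qed
  show ?thesis
  proof (cases "x = y")
    case True
    have "0 = (L *v ?h) $ y + (\<Sum>x\<in>UNIV - {y}. (L *v ?h) $ x)"
      using sum_laplacian[of ?h] by (subst (asm) sum.remove[of _ y]) auto
    moreover have "(\<Sum>x\<in>UNIV - {y}. (L *v ?h) $ x) = (\<Sum>x\<in>UNIV - {y}. deg E w x)"
      using other by (intro sum.cong) auto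
    moreover have "vol E w = deg E w y + (\<Sum>x\<in>UNIV - {y}. deg E w x)"
      unfolding vol_def by (subst sum.remove[of _ y]) auto
    ultimately show ?thesis using True by simp
  qed (simp add: other)
qed

lemma vol_pos: "0 < vol E w"
  unfolding vol_def by (intro sum_pos deg_pos[OF G con]) auto

text \<open>Symmetry moves \<open>L\<close> from \<open>u\<close> onto a column of \<open>H\<close>,
  leaving \<open>- vol E w * u $ y\<close> plus a constant \<open>s\<close>, which disappears
  against the zero sum of \<open>g\<close>.\<close>

lemma hitting_time_formula:
  assumes u: "L *v u = g" and g: "(\<Sum>x\<in>UNIV. g $ x) = 0"
  shows "u \<bullet> g = - (1 / vol E w) * (\<Sum>x\<in>UNIV. \<Sum>y\<in>UNIV. g $ x * g $ y * H x y)"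
proof -
  define s where "s = (\<Sum>x\<in>UNIV. u $ x * deg E w x)"
  have col: "(\<Sum>x\<in>UNIV. g $ x * H x y) = s - vol E w * u $ y" for y
  proof -
    have "(\<Sum>x\<in>UNIV. g $ x * H x y) = (L *v u) \<bullet> (\<chi> x. H x y)"
      by (simp add: u inner_vec_def)
    also have "\<dots> = u \<bullet> (L *v (\<chi> x. H x y))"
      by (simp add: laplacian_sym)
    also have "\<dots> = (\<Sum>x\<in>UNIV. u $ x * deg E w x - (if x = y then vol E w * u $ x else 0))"
      by (simp add: inner_vec_def laplacian_H) (intro sum.cong, auto simp: algebra_simps)
    finally show ?thesis by (simp add: sum_subtractf s_def)
  qed
  have "(\<Sum>x\<in>UNIV. \<Sum>y\<in>UNIV. g $ x * g $ y * H x y) = (\<Sum>y\<in>UNIV. g $ y * (\<Sum>x\<in>UNIV. g $ x * H x y))"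
    by (subst sum.swap) (simp add: sum_distrib_left ac_simps)
  also have "\<dots> = (\<Sum>y\<in>UNIV. g $ y) * s - vol E w * (u \<bullet> g)"
    by (simp add: col right_diff_distrib sum_subtractf sum_distrib_right sum_distrib_left
        inner_vec_def ac_simps)
  finally show ?thesis using vol_pos g by simp
qed

end

theorem theorem1p5:
  fixes E :: "'v::finite set set" and w :: "'v set \<Rightarrow> real" and \<mu> \<nu> :: "real^'v"
  assumes "weighted_graph E w" and "edges_connected E"
    and "prob_density \<mu>" and "prob_density \<nu>"
  shows
    "(\<forall>E'. orientation E E' \<longrightarrow>
       ereal (resistance E w \<mu> \<nu>) =
         Inf {ereal (flow_energy w E' J) | J.
                J \<in> E' \<rightarrow>\<^sub>E UNIV \<and> incidence_mult E' J = \<mu> - \<nu>})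
     \<and>
     (\<forall>E'. orientation E E' \<longrightarrow>
       ereal (resistance E w \<mu> \<nu>) =
         Inf {path_action w E' J | \<rho> J. admissible_path E' \<mu> \<nu> \<rho> J})
     \<and>
     ereal (resistance E w \<mu> \<nu>) = Hneg1_norm_sq E w (\<mu> - \<nu>)
     \<and>
     (\<forall>T\<^sub>1. (\<forall>F\<in>spanning_2_forests E. T\<^sub>1 F \<in> edge_components F) \<longrightarrow>
       resistance E w \<mu> \<nu> =
         1 / tree_weight_sum E w *
         (\<Sum>F\<in>spanning_2_forests E. weight_prod w F * (mass \<mu> (T\<^sub>1 F) - mass \<nu> (T\<^sub>1 F))\<^sup>2))
     \<and>
     (\<forall>x y. expected_hitting_time E w x y < \<infinity>) \<and>
     resistance E w \<mu> \<nu> =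
       - (1 / vol E w) *
       (\<Sum>x\<in>UNIV. \<Sum>y\<in>UNIV. (\<mu> $ x - \<nu> $ x) * (\<mu> $ y - \<nu> $ y) *
          enn2real (expected_hitting_time E w x y))"
proof -
  interpret connected_graph E w by unfold_locales (fact assms)+
  let ?g = "\<mu> - \<nu>"
  have g: "(\<Sum>x\<in>UNIV. ?g $ x) = 0"
    using assms(3,4) by (simp add: prob_density_def sum_subtractf)
  then obtain u where u: "L *v u = ?g" using laplacian_solvable by blast
  have R: "resistance E w \<mu> \<nu> = u \<bullet> ?g" by (rule resistance_eq_inner[OF u])
  have forest: "resistance E w \<mu> \<nu> = 1 / tree_weight_sum E w *
      (\<Sum>F\<in>spanning_2_forests E. weight_prod w F * (mass \<mu> (T F) - mass \<nu> (T F))\<^sup>2)"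
    if T: "\<forall>F\<in>spanning_2_forests E. T F \<in> edge_components F" for T
  proof -
    \<comment> \<open>A second potential with the same Laplacian as \<open>u\<close>;
      \<open>resistance_eq_inner\<close> applies to it equally.\<close>
    let ?\<phi> = "forest_potential (\<lambda>x. ?g $ x)"
    have "(L *v ?\<phi>) $ x = ?g $ x" for x by (rule laplacian_forest_potential[OF g])
    then have "L *v ?\<phi> = ?g" unfolding vec_eq_iff by blast
    then have "resistance E w \<mu> \<nu> = (\<Sum>x\<in>UNIV. ?\<phi> $ x * ?g $ x)"
      using resistance_eq_inner by (simp add: inner_vec_def)
    also have "\<dots> = 1 / tree_weight_sum E w *
        (\<Sum>F\<in>spanning_2_forests E. weight_prod w F * (\<Sum>x\<in>T F. ?g $ x)\<^sup>2)"
      using T by (intro forest_formula[OF g]) blast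
    finally show ?thesis by (simp add: mass_def sum_subtractf)
  qed
  show ?thesis
  proof (intro conjI allI impI)
    show "ereal (resistance E w \<mu> \<nu>) =
        Inf {ereal (flow_energy w E' J) | J. J \<in> E' \<rightarrow>\<^sub>E UNIV \<and> incidence_mult E' J = ?g}"
      if "orientation E E'" for E'
      unfolding R by (rule beckmann[OF that u])
    show "ereal (resistance E w \<mu> \<nu>) = Inf {path_action w E' J | \<rho> J. admissible_path E' \<mu> \<nu> \<rho> J}"
      if "orientation E E'" for E'
      unfolding R by (rule benamou_brenier[OF that u refl])
    show "ereal (resistance E w \<mu> \<nu>) = Hneg1_norm_sq E w ?g"
      unfolding R by (rule Hneg1_norm_sq_eq[OF u])
    show "expected_hitting_time E w x y < \<infinity>" for x y
      by (rule expected_hitting_time_finite)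
    show "resistance E w \<mu> \<nu> = - (1 / vol E w) * (\<Sum>x\<in>UNIV. \<Sum>y\<in>UNIV.
        (\<mu> $ x - \<nu> $ x) * (\<mu> $ y - \<nu> $ y) * enn2real (expected_hitting_time E w x y))"
      unfolding R using hitting_time_formula[OF u g] by simp
  qed (rule forest, blast)
qed

end
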